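(* Let $d\in\{2,3,\dots\}\cup\{\infty\}$ and let $\underline{A}=(A_1,\dots,A_d)$ be an ergodic coisometric row contraction on a complex separable Hilbert space $\mathcal{H}$ with $A_i^*\Omega_{\mathcal{H}}=\overline{\omega}_i\Omega_{\mathcal{H}}$ for all $i$, where $\Omega_{\mathcal{H}}\in\mathcal{H}$ is a unit vector and $\underline{\omega}\in\mathbb{C}^d$, $\sum_i|\omega_i|^2=1$. For $i\in\{1,\dots,d\}$ and $h\in\mathcal{H}$ let $d_h^i:=D_A(0,\dots,0,h,0,\dots,0)\in\mathcal{D}_A$ ($h$ in the $i$-th position). Then the extended characteristic function $\hat\theta:\mathcal{D}_A\to\Gamma(\mathbb{C}^d)\otimes\mathcal{D}_\omega$ of $\underline{A}$ is given by $$\hat\theta\,d^i_{\Omega_{\mathcal{H}}}=e_0\otimes\Big[e_i-\sum_j\langle A_j\Omega_{\mathcal{H}},A_i\Omega_{\mathcal{H}}\rangle e_j\Big]-\sum_{|\alpha|\ge1}e_\alpha\otimes\sum_j\langle\mathring{A}_\alpha\ell_j,\ell_i\rangle e_j,$$ and, for $h\in\mathring{\mathcal{H}}=\mathcal{H}\ominus\mathbb{C}\Omega_{\mathcal{H}}$, $$\hat\theta\,d^i_h=-e_0\otimes\hat D_*\mathring{A}_ih+\sum_{j=1}^de_j\otimes\sum_{\alpha\in\tilde\Lambda}e_\alpha\otimes\hat D_*\mathring{A}_\alpha^*(\delta_{ji}\mathbf{1}-\mathring{A}_j^*\mathring{A}_i)h.$$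
   Context: Inner products are linear in the second argument. If $d=\infty$, infinite sums of operators are strong limits and $\mathbb{C}^d=\ell^2(\mathbb{N})$. Coisometric: $\sum_iA_iA_i^*=\mathbf{1}$. Ergodic: the only fixed points of $Z(x)=\sum_iA_ixA_i^*$ on $B(\mathcal{H})$ are scalar multiples of $\mathbf{1}$. Multi-indices: $\Lambda=\{1,\dots,d\}$, $\tilde\Lambda=\bigcup_{n\ge0}\Lambda^n$ (with $\Lambda^0=\{0\}$), $|\alpha|=n$ for $\alpha\in\Lambda^n$, $T_\alpha=T_{\alpha_1}\cdots T_{\alpha_n}$, $T_0=\mathbf{1}$, $T_\alpha^*=(T_\alpha)^*$. Block form: with respect to $\mathcal{H}=\mathbb{C}\Omega_{\mathcal{H}}\oplus\mathring{\mathcal{H}}$ one has $A_i\Omega_{\mathcal{H}}=\omega_i\Omega_{\mathcal{H}}+\ell_i$ with $\ell_i\in\mathring{\mathcal{H}}$, and $\mathring{\mathcal{H}}$ is invariant under $A_i$; $\mathring{A}_i:=A_i|_{\mathring{\mathcal{H}}}\in B(\mathring{\mathcal{H}})$. Fock space: $\Gamma(\mathbb{C}^d)=\mathbb{C}e_0\oplus\mathbb{C}^d\oplus(\mathbb{C}^d)^{\otimes2}\oplus\cdots$, vacuum $e_0$, standard basis $e_1,\dots,e_d$ of $\mathbb{C}^d$, $e_\alpha=e_{\alpha_1}\otimes\cdots\otimes e_{\alpha_n}$, $L_ix=e_i\otimes x$, where $e_j\otimes e_0$ is read as $e_j$. $D_A=(\mathbf{1}-\underline{A}^*\underline{A})^{1/2}$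 on $\bigoplus_1^d\mathcal{H}$ (with $\underline{A}:\bigoplus_1^d\mathcal{H}\to\mathcal{H}$ the row operator) is a projection with range $\mathcal{D}_A$. Popescu's minimal isometric dilation of $\underline{A}$ on $\mathcal{H}\oplus(\Gamma(\mathbb{C}^d)\otimes\mathcal{D}_A)$ is $V_i(h\oplus\xi)=A_ih\oplus[e_0\otimes d_h^i+(L_i\otimes\mathbf{1})\xi]$. The same construction for the row $\underline{\omega}:\mathbb{C}^d\to\mathbb{C}$ gives isometries $\tilde V_i$ on $\mathbb{C}\oplus(\Gamma(\mathbb{C}^d)\otimes\mathcal{D}_\omega)$, where $\mathcal{D}_\omega=\mathbb{C}^d\ominus\mathbb{C}(\overline{\omega}_1,\dots,\overline{\omega}_d)^T$. There is a unique unitary $W:\mathcal{H}\oplus(\Gamma(\mathbb{C}^d)\otimes\mathcal{D}_A)\to\mathbb{C}\oplus(\Gamma(\mathbb{C}^d)\otimes\mathcal{D}_\omega)$ with $WV_i=\tilde V_iW$ for all $i$ and $W\Omega_{\mathcal{H}}=1\in\mathbb{C}$; it maps $\Gamma(\mathbb{C}^d)\otimes\mathcal{D}_A$ into $\Gamma(\mathbb{C}^d)\otimes\mathcal{D}_\omega$. The extended characteristic function is $\hat\theta(x)=W(e_0\otimes x)$, $x\in\mathcal{D}_A$. The map $\hat D_*:\mathring{\mathcal{H}}\to\mathcal{D}_\omega$ is $\hat D_*h=\sum_i\langle\ell_i,h\rangle e_i$. *)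

theory Defs
  imports "HOL-Analysis.Analysis"
begin

section \<open>Complex Hilbert spaces\<close>

text \<open>
  A complex inner product space is presented as a real inner product space (so that norm, topology
  and summability are those of HOL-Analysis) with a compatible complex structure; the real inner
  product is the real part of the complex one.  The complex inner product is linear in the
  \<^emph>\<open>second\<close> argument.
\<close>

class complex_inner = real_inner +
  fixes scaleC :: "complex \<Rightarrow> 'a \<Rightarrow> 'a"  (infixr \<open>*\<^sub>C\<close> 75)
    and cinner :: "'a \<Rightarrow> 'a \<Rightarrow> complex"
  assumes scaleC_add_right: "c *\<^sub>C (x + y) = c *\<^sub>C x + c *\<^sub>C y"
    and scaleC_add_left: "(c + d) *\<^sub>C x = c *\<^sub>C x + d *\<^sub>C x"
    and scaleC_scaleC [simp]: "c *\<^sub>C d *\<^sub>C x = (c * d) *\<^sub>C x"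
    and scaleR_scaleC: "r *\<^sub>R x = complex_of_real r *\<^sub>C x"
    and cinner_commute: "cinner x y = cnj (cinner y x)"
    and cinner_add_right: "cinner x (y + z) = cinner x y + cinner x z"
    and cinner_scaleC_right [simp]: "cinner x (c *\<^sub>C y) = c * cinner x y"
    and inner_eq_Re_cinner: "inner x y = Re (cinner x y)"

class chilbert_space = complex_inner + complete_space

lemma scaleC_one [simp]: "1 *\<^sub>C x = (x :: 'a :: complex_inner)"
  using scaleR_scaleC[of 1 x] by simp

lemma cinner_add_left: "cinner (x + y) z = cinner x z + cinner y (z :: 'a :: complex_inner)"
  by (metis cinner_add_right cinner_commute complex_cnj_add)

lemma cinner_scaleC_left [simp]: "cinner (c *\<^sub>C x) y = cnj c * cinner x (y :: 'a :: complex_inner)"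
  by (metis cinner_scaleC_right cinner_commute complex_cnj_mult)

lemma scaleC_zero_right [simp]: "c *\<^sub>C 0 = (0 :: 'a :: complex_inner)"
  using scaleC_add_right[of c 0 0] by simp

lemma scaleC_zero_left [simp]: "0 *\<^sub>C x = (0 :: 'a :: complex_inner)"
  using scaleC_add_left[of 0 0 x] by simp

lemma cinner_zero_right [simp]: "cinner x 0 = (0 :: complex)" for x :: "'a :: complex_inner"
  using cinner_add_right[of x 0 0] by simp

lemma cinner_zero_left [simp]: "cinner 0 x = (0 :: complex)" for x :: "'a :: complex_inner"
  using cinner_add_left[of 0 0 x] by simp

lemma cinner_self: "cinner x x = complex_of_real ((norm x)\<^sup>2)" for x :: "'a :: complex_inner"
proof -
  have "Im (cinner x x) = 0"
    using cinner_commute[of x x] by (metis complex_cnj_cancel_iff cnj.simps(2) equal_neg_zero)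
  moreover have "Re (cinner x x) = (norm x)\<^sup>2"
    by (simp add: inner_eq_Re_cinner[symmetric] power2_norm_eq_inner)
  ultimately show ?thesis by (simp add: complex_eq_iff)
qed

lemma norm_scaleC [simp]: "norm (c *\<^sub>C x) = cmod c * norm x" for x :: "'a :: complex_inner"
proof -
  have "complex_of_real ((norm (c *\<^sub>C x))\<^sup>2) = cnj c * c * complex_of_real ((norm x)\<^sup>2)"
    by (simp only: cinner_self[symmetric] cinner_scaleC_left cinner_scaleC_right mult.assoc)
       (simp add: cinner_self mult.left_commute)
  also have "\<dots> = complex_of_real ((cmod c * norm x)\<^sup>2)"
    by (simp add: complex_norm_square power_mult_distrib mult.commute flip: of_real_power)
  finally have "(norm (c *\<^sub>C x))\<^sup>2 = (cmod c * norm x)\<^sup>2"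
    by (simp only: of_real_eq_iff)
  thus ?thesis by (simp add: power2_eq_iff_nonneg)
qed

lemma cinner_Im: "Im (cinner x y) = inner (\<i> *\<^sub>C x) y" for x :: "'a :: complex_inner"
  by (simp add: inner_eq_Re_cinner)

lemma norm_cinner_le: "cmod (cinner x y) \<le> 2 * (norm x * norm y)" for x :: "'a :: complex_inner"
proof -
  have "\<bar>Re (cinner x y)\<bar> \<le> norm x * norm y"
    using Cauchy_Schwarz_ineq2[of x y] by (simp add: inner_eq_Re_cinner)
  moreover have "\<bar>Im (cinner x y)\<bar> \<le> norm x * norm y"
    using Cauchy_Schwarz_ineq2[of "\<i> *\<^sub>C x" y] by (simp add: cinner_Im)
  ultimately show ?thesis
    using cmod_le[of "cinner x y"] by linarith
qed

instantiation complex :: chilbert_space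
begin

definition scaleC_complex :: "complex \<Rightarrow> complex \<Rightarrow> complex" where
  "scaleC_complex c x = c * x"

definition cinner_complex :: "complex \<Rightarrow> complex \<Rightarrow> complex" where
  "cinner_complex x y = cnj x * y"

instance
  by standard (auto simp: scaleC_complex_def cinner_complex_def algebra_simps scaleR_conv_of_real
      inner_complex_def)

end

instantiation prod :: (complex_inner, complex_inner) complex_inner
begin

definition scaleC_prod :: "complex \<Rightarrow> 'a \<times> 'b \<Rightarrow> 'a \<times> 'b" where
  "scaleC_prod c x = (c *\<^sub>C fst x, c *\<^sub>C snd x)"

definition cinner_prod :: "'a \<times> 'b \<Rightarrow> 'a \<times> 'b \<Rightarrow> complex" where
  "cinner_prod x y = cinner (fst x) (fst y) + cinner (snd x) (snd y)"

instance
proof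
  fix x y :: "'a \<times> 'b"
  show "cinner x y = cnj (cinner y x)"
    unfolding cinner_prod_def complex_cnj_add
    by (simp add: cinner_commute[of "fst x"] cinner_commute[of "snd x"])
qed (auto simp: scaleC_prod_def cinner_prod_def scaleC_add_right scaleC_add_left scaleR_scaleC
      cinner_add_right inner_prod_def inner_eq_Re_cinner algebra_simps prod_eq_iff)

end

instance prod :: (chilbert_space, chilbert_space) chilbert_space ..


section \<open>Hilbert direct sums\<close>

typedef (overloaded) ('i, 'a :: complex_inner) ell2 =
    "{f :: 'i \<Rightarrow> 'a. (\<lambda>i. (norm (f i))\<^sup>2) summable_on UNIV}"
  morphisms coord Abs_ell2
  by (rule exI[of _ "\<lambda>_. 0"]) auto

text \<open>
  \<^typ>\<open>('i, 'a) ell2\<close> is the Hilbert space direct sum of copies of \<^typ>\<open>'a\<close> indexed by \<^typ>\<open>'i\<close>.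
  For a type \<^typ>\<open>'d\<close> of labels \<open>{1, \<dots>, d}\<close>, \<^typ>\<open>('d, complex) ell2\<close> is \<open>\<complex>\<^sup>d\<close>
  (\<open>\<ell>\<^sup>2(\<nat>)\<close> if \<open>d = \<infinity>\<close>), and \<^typ>\<open>('d, 'h) ell2\<close> is the direct sum of \<open>d\<close> copies of
  \<^typ>\<open>'h\<close>.
\<close>

setup_lifting type_definition_ell2

lemma coord_summable: "(\<lambda>i. (norm (coord x i))\<^sup>2) summable_on UNIV"
  using coord[of x] by simp

lemma ell2_eqI: "(\<And>i. coord x i = coord y i) \<Longrightarrow> x = y"
  by (metis coord_inject ext)

lemma sq_norm_add_le: "(norm (x + y))\<^sup>2 \<le> 2 * (norm x)\<^sup>2 + 2 * (norm (y :: 'a :: real_normed_vector))\<^sup>2"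
proof -
  have "(norm (x + y))\<^sup>2 \<le> (norm x + norm y)\<^sup>2"
    by (simp add: norm_triangle_ineq power_mono)
  also have "\<dots> \<le> 2 * (norm x)\<^sup>2 + 2 * (norm y)\<^sup>2"
    using sum_squares_bound[of "norm x" "norm y"] by (simp add: power2_sum)
  finally show ?thesis .
qed

lemma ell2_add_summable:
  assumes "(\<lambda>i. (norm (f i))\<^sup>2) summable_on A" "(\<lambda>i. (norm (g i))\<^sup>2) summable_on A"
  shows "(\<lambda>i. (norm (f i + g i :: 'a :: real_normed_vector))\<^sup>2) summable_on A"
proof (rule summable_on_comparison_test)
  show "(\<lambda>i. 2 * (norm (f i))\<^sup>2 + 2 * (norm (g i))\<^sup>2) summable_on A"
    by (intro summable_on_add summable_on_cmult_right assms)
qed (auto intro: sq_norm_add_le)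

lemma ell2_cinner_abs_summable:
  assumes "(\<lambda>i. (norm (f i))\<^sup>2) summable_on A" "(\<lambda>i. (norm (g i))\<^sup>2) summable_on A"
  shows "(\<lambda>i. norm (cinner (f i) (g i :: 'a :: complex_inner))) summable_on A"
proof (rule summable_on_comparison_test)
  show "(\<lambda>i. (norm (f i))\<^sup>2 + (norm (g i))\<^sup>2) summable_on A"
    by (intro summable_on_add assms)
next
  fix i
  show "cmod (cinner (f i) (g i)) \<le> (norm (f i))\<^sup>2 + (norm (g i))\<^sup>2"
    using norm_cinner_le[of "f i" "g i"] sum_squares_bound[of "norm (f i)" "norm (g i)"]
    by simp
qed auto

lemma ell2_inner_summable:
  assumes "(\<lambda>i. (norm (f i))\<^sup>2) summable_on A" "(\<lambda>i. (norm (g i))\<^sup>2) summable_on A"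
  shows "(\<lambda>i. inner (f i) (g i :: 'a :: complex_inner)) summable_on A"
  unfolding inner_eq_Re_cinner
  by (rule summable_on_Re[OF abs_summable_summable[OF ell2_cinner_abs_summable[OF assms]]])

instantiation ell2 :: (type, complex_inner) real_vector
begin

lift_definition zero_ell2 :: "('a, 'b) ell2" is "\<lambda>_. 0"
  by auto

lift_definition plus_ell2 :: "('a, 'b) ell2 \<Rightarrow> ('a, 'b) ell2 \<Rightarrow> ('a, 'b) ell2" is
  "\<lambda>f g i. f i + g i"
  by (simp add: ell2_add_summable)

lift_definition uminus_ell2 :: "('a, 'b) ell2 \<Rightarrow> ('a, 'b) ell2" is "\<lambda>f i. - f i"
  by simp

lift_definition minus_ell2 :: "('a, 'b) ell2 \<Rightarrow> ('a, 'b) ell2 \<Rightarrow> ('a, 'b) ell2" is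
  "\<lambda>f g i. f i - g i"
  using ell2_add_summable[of _ UNIV "\<lambda>i. - _ i"] by simp

lift_definition scaleR_ell2 :: "real \<Rightarrow> ('a, 'b) ell2 \<Rightarrow> ('a, 'b) ell2" is
  "\<lambda>c f i. c *\<^sub>R f i"
  by (simp add: power_mult_distrib summable_on_cmult_right)

instance
proof
  fix x y z :: "('a, 'b) ell2" and a b :: real
  show "x + y + z = x + (y + z)" "x + y = y + x" "0 + x = x" "- x + x = 0" "x - y = x + - y"
    by (transfer; simp add: algebra_simps)+
  show "a *\<^sub>R (x + y) = a *\<^sub>R x + a *\<^sub>R y" "(a + b) *\<^sub>R x = a *\<^sub>R x + b *\<^sub>R x"
    "a *\<^sub>R b *\<^sub>R x = (a * b) *\<^sub>R x" "1 *\<^sub>R x = x"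
    by (transfer; simp add: algebra_simps)+
qed

end

instantiation ell2 :: (type, complex_inner) complex_inner
begin

lift_definition scaleC_ell2 :: "complex \<Rightarrow> ('a, 'b) ell2 \<Rightarrow> ('a, 'b) ell2" is
  "\<lambda>c f i. c *\<^sub>C f i"
  by (simp add: power_mult_distrib summable_on_cmult_right)

definition cinner_ell2 :: "('a, 'b) ell2 \<Rightarrow> ('a, 'b) ell2 \<Rightarrow> complex" where
  "cinner_ell2 x y = (\<Sum>\<^sub>\<infinity>i. cinner (coord x i) (coord y i))"

definition inner_ell2 :: "('a, 'b) ell2 \<Rightarrow> ('a, 'b) ell2 \<Rightarrow> real" where
  "inner_ell2 x y = (\<Sum>\<^sub>\<infinity>i. inner (coord x i) (coord y i))"

definition norm_ell2 :: "('a, 'b) ell2 \<Rightarrow> real" where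
  "norm_ell2 x = sqrt (inner x x)"

definition dist_ell2 :: "('a, 'b) ell2 \<Rightarrow> ('a, 'b) ell2 \<Rightarrow> real" where
  "dist_ell2 x y = norm (x - y)"

definition sgn_ell2 :: "('a, 'b) ell2 \<Rightarrow> ('a, 'b) ell2" where
  "sgn_ell2 x = x /\<^sub>R norm x"

definition uniformity_ell2 :: "(('a, 'b) ell2 \<times> ('a, 'b) ell2) filter" where
  "uniformity_ell2 = (INF e\<in>{0<..}. principal {(x, y). dist x y < e})"

definition open_ell2 :: "('a, 'b) ell2 set \<Rightarrow> bool" where
  "open_ell2 U = (\<forall>x\<in>U. eventually (\<lambda>(x', y). x' = x \<longrightarrow> y \<in> U) uniformity)"

lemma ell2_cinner_has_sum:
  "((\<lambda>i. cinner (coord x i) (coord y i)) has_sum cinner x (y :: ('a, 'b) ell2)) UNIV"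
  unfolding cinner_ell2_def
  by (rule has_sum_infsum[OF abs_summable_summable[OF ell2_cinner_abs_summable[OF coord_summable coord_summable]]])

lemma ell2_inner_has_sum:
  "((\<lambda>i. inner (coord x i) (coord y i)) has_sum inner x (y :: ('a, 'b) ell2)) UNIV"
  unfolding inner_ell2_def
  by (rule has_sum_infsum[OF ell2_inner_summable[OF coord_summable coord_summable]])

instance
proof
  fix x y z :: "('a, 'b) ell2" and c d :: complex and a b :: real
  show "c *\<^sub>C (x + y) = c *\<^sub>C x + c *\<^sub>C y" "(c + d) *\<^sub>C x = c *\<^sub>C x + d *\<^sub>C x"
    "c *\<^sub>C d *\<^sub>C x = (c * d) *\<^sub>C x" "a *\<^sub>R x = complex_of_real a *\<^sub>C x"
    by (transfer; simp add: scaleC_add_right scaleC_add_left scaleR_scaleC)+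
  show "sgn x = x /\<^sub>R norm x" by (rule sgn_ell2_def)
  show "dist x y = norm (x - y)" by (rule dist_ell2_def)
  show "uniformity = (INF e\<in>{0<..}. principal {(x, y :: ('a, 'b) ell2). dist x y < e})"
    by (rule uniformity_ell2_def)
  show "open U = (\<forall>x\<in>U. \<forall>\<^sub>F (x', y) in uniformity. x' = x \<longrightarrow> y \<in> U)"
    for U :: "('a, 'b) ell2 set" by (rule open_ell2_def)
  show "norm x = sqrt (inner x x)" by (rule norm_ell2_def)
  show "inner x y = inner y x" by (simp add: inner_ell2_def inner_commute)
  show "0 \<le> inner x x" unfolding inner_ell2_def by (intro infsum_nonneg) simp
  have coord_add: "coord (x + y) i = coord x i + coord y i" for i x and y :: "('a, 'b) ell2"
    by transfer simp
  have coord_scaleR: "coord (a *\<^sub>R x) i = a *\<^sub>R coord x i" for i by transfer simp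
  have coord_scaleC: "coord (c *\<^sub>C y) i = c *\<^sub>C coord y i" for i by transfer simp
  show "inner (x + y) z = inner x z + inner y z"
    using has_sum_add[OF ell2_inner_has_sum[of x z] ell2_inner_has_sum[of y z]]
      ell2_inner_has_sum[of "x + y" z]
    by (simp add: coord_add inner_add_left has_sum_unique)
  show "inner (a *\<^sub>R x) y = a * inner x y"
    using has_sum_cmult_right[OF ell2_inner_has_sum[of x y], of a]
      ell2_inner_has_sum[of "a *\<^sub>R x" y]
    by (simp add: coord_scaleR has_sum_unique)
  show "inner x x = 0 \<longleftrightarrow> x = 0"
  proof
    assume "inner x x = 0"
    hence "((\<lambda>i. inner (coord x i) (coord x i)) has_sum 0) UNIV"
      using ell2_inner_has_sum[of x x] by simp
    hence "inner (coord x i) (coord x i) = 0" for i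
      using nonneg_has_sum_le_0D[of "\<lambda>i. inner (coord x i) (coord x i)" UNIV 0 i] by simp
    thus "x = 0" by (intro ell2_eqI) (simp add: zero_ell2.rep_eq)
  qed (simp add: inner_ell2_def zero_ell2.rep_eq)
  show "cinner x y = cnj (cinner y x)"
  proof -
    have "(\<lambda>i. cnj (cinner (coord y i) (coord x i))) = (\<lambda>i. cinner (coord x i) (coord y i))"
      by (rule ext) (metis cinner_commute)
    hence "((\<lambda>i. cinner (coord x i) (coord y i)) has_sum cnj (cinner y x)) UNIV"
      using ell2_cinner_has_sum[of y x] by (metis has_sum_cnj_iff)
    thus ?thesis using ell2_cinner_has_sum[of x y] has_sum_unique by blast
  qed
  show "cinner x (y + z) = cinner x y + cinner x z"
    using has_sum_add[OF ell2_cinner_has_sum[of x y] ell2_cinner_has_sum[of x z]]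
      ell2_cinner_has_sum[of x "y + z"]
    by (simp add: coord_add cinner_add_right has_sum_unique)
  show "cinner x (c *\<^sub>C y) = c * cinner x y"
    using has_sum_cmult_right[OF ell2_cinner_has_sum[of x y], of c]
      ell2_cinner_has_sum[of x "c *\<^sub>C y"]
    by (simp add: coord_scaleC has_sum_unique)
  show "inner x y = Re (cinner x y)"
    using has_sum_Re[OF ell2_cinner_has_sum[of x y]] ell2_inner_has_sum[of x y]
    by (simp add: inner_eq_Re_cinner has_sum_unique)
qed

end

lemmas coord_ell2 [simp] = zero_ell2.rep_eq plus_ell2.rep_eq uminus_ell2.rep_eq minus_ell2.rep_eq
  scaleC_ell2.rep_eq scaleR_ell2.rep_eq

lemma ell2_norm_sq_has_sum: "((\<lambda>i. (norm (coord x i))\<^sup>2) has_sum (norm x)\<^sup>2) UNIV"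
  using ell2_inner_has_sum[of x x] by (simp add: dot_square_norm)

lemma norm_coord_le: "norm (coord x i) \<le> norm x"
proof -
  have "(norm (coord x i))\<^sup>2 \<le> (norm x)\<^sup>2"
    using finite_sum_le_has_sum[OF ell2_norm_sq_has_sum[of x], of "{i}"] by simp
  thus ?thesis by (rule power2_le_imp_le) simp
qed

instance ell2 :: (type, chilbert_space) chilbert_space
proof
  fix X :: "nat \<Rightarrow> ('a, 'b) ell2"
  assume X: "Cauchy X"
  have "Cauchy (\<lambda>n. coord (X n) i)" for i
  proof (rule CauchyI)
    fix e :: real assume "e > 0"
    then obtain M where "\<And>m n. m \<ge> M \<Longrightarrow> n \<ge> M \<Longrightarrow> norm (X m - X n) < e"
      using CauchyD[OF X] by blast
    moreover have "norm (coord (X m) i - coord (X n) i) \<le> norm (X m - X n)" for m n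
      using norm_coord_le[of "X m - X n" i] by simp
    ultimately show "\<exists>M. \<forall>m\<ge>M. \<forall>n\<ge>M. norm (coord (X m) i - coord (X n) i) < e"
      by (meson le_less_trans)
  qed
  hence "\<exists>l. (\<lambda>n. coord (X n) i) \<longlonglongrightarrow> l" for i
    using Cauchy_convergent convergent_def by blast
  then obtain l where l: "\<And>i. (\<lambda>n. coord (X n) i) \<longlonglongrightarrow> l i" by metis
  have bound: "\<exists>M. \<forall>n\<ge>M. \<forall>F. finite F \<longrightarrow> (\<Sum>i\<in>F. (norm (coord (X n) i - l i))\<^sup>2) \<le> e\<^sup>2"
    if "e > 0" for e
  proof -
    obtain M where M: "\<And>m n. m \<ge> M \<Longrightarrow> n \<ge> M \<Longrightarrow> norm (X m - X n) < e"
      using CauchyD[OF X \<open>e > 0\<close>] by blast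
    have "(\<Sum>i\<in>F. (norm (coord (X n) i - l i))\<^sup>2) \<le> e\<^sup>2" if "n \<ge> M" "finite F" for n F
    proof (rule LIMSEQ_le_const2)
      show "(\<lambda>m. \<Sum>i\<in>F. (norm (coord (X n) i - coord (X m) i))\<^sup>2)
          \<longlonglongrightarrow> (\<Sum>i\<in>F. (norm (coord (X n) i - l i))\<^sup>2)"
        by (intro tendsto_intros l)
      have "(\<Sum>i\<in>F. (norm (coord (X n) i - coord (X m) i))\<^sup>2) \<le> e\<^sup>2" if "m \<ge> M" for m
      proof -
        have "(\<Sum>i\<in>F. (norm (coord (X n) i - coord (X m) i))\<^sup>2) \<le> (norm (X n - X m))\<^sup>2"
          using finite_sum_le_has_sum[OF ell2_norm_sq_has_sum[of "X n - X m"] \<open>finite F\<close>] by simp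
        also have "\<dots> \<le> e\<^sup>2" using M[OF \<open>n \<ge> M\<close> that] by (simp add: power_mono)
        finally show ?thesis .
      qed
      thus "\<exists>N. \<forall>m\<ge>N. (\<Sum>i\<in>F. (norm (coord (X n) i - coord (X m) i))\<^sup>2) \<le> e\<^sup>2" by blast
    qed
    thus ?thesis by blast
  qed
  have sum: "(\<lambda>i. (norm (coord (X n) i - l i))\<^sup>2) summable_on UNIV"
    if "\<forall>F. finite F \<longrightarrow> (\<Sum>i\<in>F. (norm (coord (X n) i - l i))\<^sup>2) \<le> e\<^sup>2" for n e
    by (rule nonneg_bounded_partial_sums_imp_summable_on[where C = "e\<^sup>2"])
      (use that in \<open>auto intro: eventually_finite_subsets_at_top_weakI\<close>)
  obtain M where "\<forall>n\<ge>M. \<forall>F. finite F \<longrightarrow> (\<Sum>i\<in>F. (norm (coord (X n) i - l i))\<^sup>2) \<le> 1\<^sup>2"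
    using bound[OF zero_less_one] by blast
  hence M: "(\<lambda>i. (norm (coord (X M) i - l i))\<^sup>2) summable_on UNIV"
    using sum[of M 1] by blast
  have "(\<lambda>i. (norm (l i))\<^sup>2) summable_on UNIV"
    using ell2_add_summable[OF coord_summable[of "X M"], of "\<lambda>i. l i - coord (X M) i"] M
    by (simp add: norm_minus_commute[of "coord (X M) _"])
  then obtain L where L: "coord L = l"
    by (metis Abs_ell2_inverse mem_Collect_eq)
  have "X \<longlonglongrightarrow> L"
  proof (rule LIMSEQ_I)
    fix e :: real assume "e > 0"
    hence "e / 2 > 0" by simp
    then obtain N where N: "\<forall>n\<ge>N. \<forall>F. finite F \<longrightarrow>
        (\<Sum>i\<in>F. (norm (coord (X n) i - l i))\<^sup>2) \<le> (e / 2)\<^sup>2"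
      using bound by blast
    have "norm (X n - L) < e" if "n \<ge> N" for n
    proof -
      have "(norm (X n - L))\<^sup>2 \<le> (e / 2)\<^sup>2"
        by (rule has_sum_le_finite_sums[OF ell2_norm_sq_has_sum]) (use N that L in simp)
      hence "norm (X n - L) \<le> e / 2"
        by (rule power2_le_imp_le) (use \<open>e > 0\<close> in simp)
      thus ?thesis using \<open>e > 0\<close> by linarith
    qed
    thus "\<exists>N. \<forall>n\<ge>N. norm (X n - L) < e" by blast
  qed
  thus "convergent X" by (auto simp: convergent_def)
qed


lift_definition single :: "'i \<Rightarrow> 'a :: complex_inner \<Rightarrow> ('i, 'a) ell2" is
  "\<lambda>i x j. if j = i then x else 0"
  by (rule finite_nonzero_values_imp_summable_on) simp

abbreviation basis :: "'i \<Rightarrow> ('i, complex) ell2" where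
  "basis i \<equiv> single i 1"

lift_definition cnj_ell2 :: "('i, complex) ell2 \<Rightarrow> ('i, complex) ell2" is "\<lambda>f i. cnj (f i)"
  by simp

text \<open>
  The tensor product of \<^typ>\<open>('i, complex) ell2\<close> with a Hilbert space \<^typ>\<open>'a\<close> is modelled by
  \<^typ>\<open>('i, 'a) ell2\<close>; the lemmas \<open>cinner_tensor\<close> and \<open>tensor_expansion\<close> show that elementary tensors
  have the right inner products and are total.
\<close>

lift_definition tensor :: "('i, complex) ell2 \<Rightarrow> 'a :: complex_inner \<Rightarrow> ('i, 'a) ell2"
    (infixr \<open>\<otimes>\<close> 72) is
  "\<lambda>f x i. f i *\<^sub>C x"
  by (simp add: power_mult_distrib summable_on_cmult_left)

lemmas coord_ell2_ops [simp] = single.rep_eq cnj_ell2.rep_eq tensor.rep_eq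

lemma cinner_tensor: "cinner (\<xi> \<otimes> x) (\<eta> \<otimes> y) = cinner \<xi> \<eta> * cinner x y"
proof -
  have "((\<lambda>i. cinner (coord (\<xi> \<otimes> x) i) (coord (\<eta> \<otimes> y) i)) has_sum cinner \<xi> \<eta> * cinner x y) UNIV"
    using has_sum_cmult_left[OF ell2_cinner_has_sum[of \<xi> \<eta>], of "cinner x y"]
    by (simp add: cinner_complex_def mult_ac)
  thus ?thesis by (rule has_sum_unique[OF ell2_cinner_has_sum])
qed

lemma basis_tensor: "basis i \<otimes> x = single i x"
  by (rule ell2_eqI) simp

lemma coord_sum [simp]: "coord (sum f F) i = (\<Sum>j\<in>F. coord (f j) i)"
  by (induction F rule: infinite_finite_induct) auto

lemma tensor_expansion: "((\<lambda>i. basis i \<otimes> coord x i) has_sum x) UNIV"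
proof -
  have "((\<lambda>F. \<Sum>i\<in>F. basis i \<otimes> coord x i) \<longlongrightarrow> x) (finite_subsets_at_top UNIV)"
  proof (rule tendstoI)
    fix e :: real assume "e > 0"
    have "((\<lambda>F. \<Sum>i\<in>F. (norm (coord x i))\<^sup>2) \<longlongrightarrow> (norm x)\<^sup>2) (finite_subsets_at_top UNIV)"
      using ell2_norm_sq_has_sum[of x] by (simp add: has_sum_def)
    hence "\<forall>\<^sub>F F in finite_subsets_at_top UNIV.
        dist (\<Sum>i\<in>F. (norm (coord x i))\<^sup>2) ((norm x)\<^sup>2) < e\<^sup>2"
      using \<open>e > 0\<close> by (simp add: tendstoD)
    moreover have "\<forall>\<^sub>F F in finite_subsets_at_top (UNIV :: 'a set). finite F"
      by (rule eventually_finite_subsets_at_top_weakI)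
    ultimately show "\<forall>\<^sub>F F in finite_subsets_at_top UNIV. dist (\<Sum>i\<in>F. basis i \<otimes> coord x i) x < e"
    proof eventually_elim
      case (elim F)
      let ?y = "x - (\<Sum>i\<in>F. basis i \<otimes> coord x i)"
      have c: "coord ?y i = (if i \<in> F then 0 else coord x i)" for i
      proof -
        have "coord (basis j \<otimes> coord x j) i = (if i = j then coord x i else 0)" for j
          by simp
        thus ?thesis using \<open>finite F\<close> by (simp add: sum.delta del: tensor.rep_eq)
      qed
      have "((\<lambda>i. (norm (coord x i))\<^sup>2) has_sum (norm x)\<^sup>2 - (\<Sum>i\<in>F. (norm (coord x i))\<^sup>2)) (UNIV - F)"
        by (rule has_sum_Diff[OF ell2_norm_sq_has_sum has_sum_finite]) (use \<open>finite F\<close> in auto)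
      also have "?this \<longleftrightarrow> ((\<lambda>i. (norm (coord ?y i))\<^sup>2) has_sum
          (norm x)\<^sup>2 - (\<Sum>i\<in>F. (norm (coord x i))\<^sup>2)) UNIV"
        by (rule has_sum_cong_neutral) (simp_all only: c, auto)
      finally have "(norm ?y)\<^sup>2 = (norm x)\<^sup>2 - (\<Sum>i\<in>F. (norm (coord x i))\<^sup>2)"
        using ell2_norm_sq_has_sum[of ?y] has_sum_unique by blast
      hence "(norm ?y)\<^sup>2 < e\<^sup>2" using elim(1) by (simp add: dist_real_def)
      hence "norm ?y < e" by (rule power2_less_imp_less) (use \<open>e > 0\<close> in simp)
      thus ?case by (simp add: dist_norm norm_minus_commute)
    qed
  qed
  thus ?thesis by (simp add: has_sum_def)
qed


section \<open>Operators\<close>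

definition bounded_clinear :: "('a :: complex_inner \<Rightarrow> 'b :: complex_inner) \<Rightarrow> bool" where
  "bounded_clinear T \<longleftrightarrow> bounded_linear T \<and> (\<forall>c x. T (c *\<^sub>C x) = c *\<^sub>C T x)"

definition corth_compl :: "'a :: complex_inner set \<Rightarrow> 'a set" where
  "corth_compl S = {y. \<forall>x\<in>S. cinner x y = 0}"

text \<open>
  The adjoint of an operator defined on a closed subspace \<open>S\<close>; its values lie in \<open>S\<close>.
\<close>

definition adj_on :: "'a :: complex_inner set \<Rightarrow> ('a \<Rightarrow> 'b :: complex_inner) \<Rightarrow> 'b \<Rightarrow> 'a" where
  "adj_on S T y = (THE z. z \<in> S \<and> (\<forall>x\<in>S. cinner x z = cinner (T x) y))"

abbreviation adj :: "('a :: complex_inner \<Rightarrow> 'b :: complex_inner) \<Rightarrow> 'b \<Rightarrow> 'a" where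
  "adj \<equiv> adj_on UNIV"

definition positive_op :: "('a :: complex_inner \<Rightarrow> 'a) \<Rightarrow> bool" where
  "positive_op T \<longleftrightarrow> bounded_clinear T \<and> (\<forall>x. cinner x (T x) \<in> \<real>\<^sub>\<ge>\<^sub>0)"

definition op_sqrt :: "('a :: complex_inner \<Rightarrow> 'a) \<Rightarrow> 'a \<Rightarrow> 'a" where
  "op_sqrt T = (THE S. positive_op S \<and> S \<circ> S = T)"

definition unitary_between ::
    "'a :: complex_inner set \<Rightarrow> 'b :: complex_inner set \<Rightarrow> ('a \<Rightarrow> 'b) \<Rightarrow> bool" where
  "unitary_between S T W \<longleftrightarrow> bij_betw W S T \<and>
    (\<forall>u\<in>S. \<forall>v\<in>S. W (u + v) = W u + W v) \<and>
    (\<forall>c. \<forall>u\<in>S. W (c *\<^sub>C u) = c *\<^sub>C W u) \<and>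
    (\<forall>u\<in>S. \<forall>v\<in>S. cinner (W u) (W v) = cinner u v)"

definition word_op :: "('d \<Rightarrow> 'a \<Rightarrow> 'a) \<Rightarrow> 'd list \<Rightarrow> 'a \<Rightarrow> 'a" where
  "word_op T \<alpha> = foldr (\<lambda>i S. T i \<circ> S) \<alpha> id"


section \<open>Row contractions\<close>

text \<open>
  All infinite operator sums are unconditional strong sums.  For the sums occurring here this agrees
  with convergence of the partial sums in any enumeration of the labels.
\<close>

definition row :: "('d \<Rightarrow> 'h :: complex_inner \<Rightarrow> 'h) \<Rightarrow> ('d, 'h) ell2 \<Rightarrow> 'h" where
  "row A x = (\<Sum>\<^sub>\<infinity>i. A i (coord x i))"

definition row_contraction :: "('d \<Rightarrow> 'h :: complex_inner \<Rightarrow> 'h) \<Rightarrow> bool" where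
  "row_contraction A \<longleftrightarrow> (\<forall>i. bounded_clinear (A i)) \<and>
    (\<forall>x. (\<lambda>i. A i (coord x i)) summable_on UNIV \<and> norm (row A x) \<le> norm x)"

definition coisometric :: "('d \<Rightarrow> 'h :: complex_inner \<Rightarrow> 'h) \<Rightarrow> bool" where
  "coisometric A \<longleftrightarrow> (\<forall>h. ((\<lambda>i. A i (adj (A i) h)) has_sum h) UNIV)"

definition ergodic :: "('d \<Rightarrow> 'h :: complex_inner \<Rightarrow> 'h) \<Rightarrow> bool" where
  "ergodic A \<longleftrightarrow> (\<forall>X. bounded_clinear X \<longrightarrow>
    (\<forall>h. ((\<lambda>i. A i (X (adj (A i) h))) has_sum X h) UNIV) \<longrightarrow> (\<exists>c. \<forall>h. X h = c *\<^sub>C h))"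

definition defect_op :: "('d \<Rightarrow> 'h :: complex_inner \<Rightarrow> 'h) \<Rightarrow> ('d, 'h) ell2 \<Rightarrow> ('d, 'h) ell2" where
  "defect_op A = op_sqrt (\<lambda>x. x - adj (row A) (row A x))"

text \<open>
  For a coisometric row the defect operator is a projection, so its range is closed.
\<close>

definition defect_space :: "('d \<Rightarrow> 'h :: complex_inner \<Rightarrow> 'h) \<Rightarrow> ('d, 'h) ell2 set" where
  "defect_space A = range (defect_op A)"

definition defect_vec :: "('d \<Rightarrow> 'h :: complex_inner \<Rightarrow> 'h) \<Rightarrow> 'd \<Rightarrow> 'h \<Rightarrow> ('d, 'h) ell2" where
  "defect_vec A i h = defect_op A (single i h)"


section \<open>Fock space and the isometric dilation\<close>

text \<open>
  Multi-indices are words, the multi-index \<open>0\<close> being \<open>[]\<close>.  The full Fock space over \<open>\<complex>\<^sup>d\<close> is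
  \<^typ>\<open>('d list, complex) ell2\<close>, with \<^term>\<open>basis \<alpha>\<close> for \<open>e\<^sub>\<alpha>\<close>, and its tensor product with a
  subspace \<open>K\<close> of \<^typ>\<open>'a\<close> is \<open>fock_tensor K\<close>.  The function \<open>creation i\<close> is \<open>L\<^sub>i\<close> on the Fock space
  and \<open>L\<^sub>i \<otimes> 1\<close> on its tensor product with a Hilbert space, see \<open>creation_tensor\<close>.
\<close>

abbreviation vacuum :: "('d list, complex) ell2" where
  "vacuum \<equiv> basis []"

definition fock_tensor :: "'a :: complex_inner set \<Rightarrow> ('d list, 'a) ell2 set" where
  "fock_tensor K = {\<xi>. \<forall>\<alpha>. coord \<xi> \<alpha> \<in> K}"

lift_definition creation :: "'d \<Rightarrow> ('d list, 'a :: complex_inner) ell2 \<Rightarrow> ('d list, 'a) ell2" is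
  "\<lambda>i f \<alpha>. case \<alpha> of [] \<Rightarrow> 0 | j # \<beta> \<Rightarrow> if j = i then f \<beta> else 0"
proof -
  fix i :: 'd and f :: "'d list \<Rightarrow> 'a"
  let ?g = "\<lambda>\<alpha>. case \<alpha> of [] \<Rightarrow> 0 | j # \<beta> \<Rightarrow> if j = i then f \<beta> else 0"
  assume "(\<lambda>\<alpha>. (norm (f \<alpha>))\<^sup>2) summable_on UNIV"
  hence "((\<lambda>\<alpha>. (norm (?g \<alpha>))\<^sup>2) \<circ> (#) i) summable_on UNIV"
    by (simp add: o_def)
  hence "(\<lambda>\<alpha>. (norm (?g \<alpha>))\<^sup>2) summable_on range ((#) i)"
    by (subst summable_on_reindex) auto
  also have "?this \<longleftrightarrow> (\<lambda>\<alpha>. (norm (?g \<alpha>))\<^sup>2) summable_on UNIV"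
    by (rule summable_on_cong_neutral) (auto split: list.splits)
  finally show "(\<lambda>\<alpha>. (norm (?g \<alpha>))\<^sup>2) summable_on UNIV" .
qed

lemma creation_basis: "creation i (basis \<alpha>) = basis (i # \<alpha>)"
  by (rule ell2_eqI) (auto simp: creation.rep_eq split: list.splits)

lemma creation_tensor: "creation i (\<xi> \<otimes> x) = creation i \<xi> \<otimes> x"
  by (rule ell2_eqI) (auto simp: creation.rep_eq split: list.splits)

text \<open>
  Popescu's minimal isometric dilation of \<open>A\<close> lives on the subspace \<open>dilation_space A\<close>; for a scalar
  row it is \<open>dilation (scalar_row \<omega>)\<close>, on \<open>\<complex> \<oplus> (\<Gamma>(\<complex>\<^sup>d) \<otimes> scalar_defect_space \<omega>)\<close>.
\<close>

definition dilation_space ::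
    "('d \<Rightarrow> 'h :: complex_inner \<Rightarrow> 'h) \<Rightarrow> ('h \<times> ('d list, ('d, 'h) ell2) ell2) set" where
  "dilation_space A = UNIV \<times> fock_tensor (defect_space A)"

definition dilation :: "('d \<Rightarrow> 'h :: complex_inner \<Rightarrow> 'h) \<Rightarrow> 'd \<Rightarrow>
    'h \<times> ('d list, ('d, 'h) ell2) ell2 \<Rightarrow> 'h \<times> ('d list, ('d, 'h) ell2) ell2" where
  "dilation A i = (\<lambda>(h, \<xi>). (A i h, vacuum \<otimes> defect_vec A i h + creation i \<xi>))"


section \<open>The extended characteristic function\<close>

definition scalar_row :: "('d, complex) ell2 \<Rightarrow> 'd \<Rightarrow> complex \<Rightarrow> complex" where
  "scalar_row \<omega> i z = coord \<omega> i * z"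

definition scalar_defect_space :: "('d, complex) ell2 \<Rightarrow> ('d, complex) ell2 set" where
  "scalar_defect_space \<omega> = corth_compl {cnj_ell2 \<omega>}"

definition is_intertwiner :: "('d \<Rightarrow> 'h :: complex_inner \<Rightarrow> 'h) \<Rightarrow> 'h \<Rightarrow> ('d, complex) ell2 \<Rightarrow>
    ('h \<times> ('d list, ('d, 'h) ell2) ell2 \<Rightarrow> complex \<times> ('d list, ('d, complex) ell2) ell2) \<Rightarrow> bool" where
  "is_intertwiner A \<Omega> \<omega> W \<longleftrightarrow>
    unitary_between (dilation_space A) (UNIV \<times> fock_tensor (scalar_defect_space \<omega>)) W \<and>
    (\<forall>i. \<forall>u\<in>dilation_space A. W (dilation A i u) = dilation (scalar_row \<omega>) i (W u)) \<and>
    W (\<Omega>, 0) = (1, 0)"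

text \<open>
  The intertwining unitary \<open>W\<close> exists and is unique on \<^term>\<open>dilation_space A\<close>; the choice operator
  only fixes its irrelevant values off this subspace.  The function \<open>ext_char_fun\<close> takes its values
  in \<open>\<complex> \<oplus> (\<Gamma>(\<complex>\<^sup>d) \<otimes> \<complex>\<^sup>d)\<close>, in which \<open>\<Gamma>(\<complex>\<^sup>d) \<otimes> \<complex>\<^sup>d\<close> is embedded as the second summand.
\<close>

definition ext_char_fun :: "('d \<Rightarrow> 'h :: complex_inner \<Rightarrow> 'h) \<Rightarrow> 'h \<Rightarrow> ('d, complex) ell2 \<Rightarrow>
    ('d, 'h) ell2 \<Rightarrow> complex \<times> ('d list, ('d, complex) ell2) ell2" where
  "ext_char_fun A \<Omega> \<omega> x = (SOME W. is_intertwiner A \<Omega> \<omega> W) (0, vacuum \<otimes> x)"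


section \<open>The block decomposition\<close>

definition ell :: "('d \<Rightarrow> 'h :: complex_inner \<Rightarrow> 'h) \<Rightarrow> 'h \<Rightarrow> ('d, complex) ell2 \<Rightarrow> 'd \<Rightarrow> 'h" where
  "ell A \<Omega> \<omega> i = A i \<Omega> - coord \<omega> i *\<^sub>C \<Omega>"

definition ring_op :: "('d \<Rightarrow> 'h :: complex_inner \<Rightarrow> 'h) \<Rightarrow> 'h \<Rightarrow> 'd \<Rightarrow> 'h \<Rightarrow> 'h" where
  "ring_op A \<Omega> i = restrict (A i) (corth_compl {\<Omega>})"

definition hat_D :: "('d \<Rightarrow> 'h :: complex_inner \<Rightarrow> 'h) \<Rightarrow> 'h \<Rightarrow> ('d, complex) ell2 \<Rightarrow>
    'h \<Rightarrow> ('d, complex) ell2" where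
  "hat_D A \<Omega> \<omega> h = (\<Sum>\<^sub>\<infinity>i. cinner (ell A \<Omega> \<omega> i) h *\<^sub>C basis i)"

end

theory Submission
  imports Defs
begin

text \<open>
  Every \<open>h\<close> is sent to \<open>T h = (\<langle>\<Omega>, h\<rangle>, \<Sum>\<^sub>\<alpha> e\<^sub>\<alpha> \<otimes> D\<^sub>* A\<^sub>\<alpha>\<^sup>* h)\<close>, a contraction by a telescoping estimate.  Since
  \<open>T\<^sup>* T\<close> is a fixed point of \<open>Z\<close> and \<open>T \<Omega> = (1, 0)\<close>, ergodicity makes \<open>T\<close> isometric.  As \<open>T\<close> intertwines
  the adjoints of \<open>A\<^sub>i\<close> with those of the dilation \<open>S\<^sub>i\<close> of the scalar row, it extends to
  \<open>W (h, \<xi>) = T h + \<Sum>\<^sub>\<alpha> S\<^sub>\<alpha> \<Phi> \<xi>\<^sub>\<alpha>\<close> with \<open>\<Phi> x = \<Sum>\<^sub>i S\<^sub>i T x\<^sub>i\<close>, an intertwining isometry that is onto because the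
  dilation of the scalar row is minimal.  Hence the extended characteristic function is \<open>\<Phi>\<close> on the
  defect space, the kernel of the row operator, and there \<open>\<Phi> x\<close> has the components
  \<open>(\<langle>\<Omega>, x\<^sub>i\<rangle>)\<^sub>i\<close> at the vacuum and \<open>D\<^sub>* A\<^sub>\<alpha>\<^sup>* x\<^sub>i\<close> at \<open>e\<^sub>i \<otimes> e\<^sub>\<alpha>\<close>.
\<close>

section \<open>Complex inner products and adjoints\<close>

lemma scaleC_minus1: "(- 1) *\<^sub>C x = - (x :: 'a :: complex_inner)"
  using scaleR_scaleC[of "-1" x] by simp

lemma cinner_minus_right [simp]: "cinner x (- y) = - cinner x (y :: 'a :: complex_inner)"
  using cinner_scaleC_right[of x "-1" y] by (simp add: scaleC_minus1)

lemma cinner_minus_left [simp]: "cinner (- x) y = - cinner x (y :: 'a :: complex_inner)"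
  using cinner_scaleC_left[of "-1" x y] by (simp add: scaleC_minus1)

lemma cinner_diff_right: "cinner x (y - z) = cinner x y - cinner x (z :: 'a :: complex_inner)"
  using cinner_add_right[of x y "- z"] by simp

lemma cinner_diff_left: "cinner (x - y) z = cinner x z - cinner y (z :: 'a :: complex_inner)"
  using cinner_add_left[of x "- y" z] by simp

lemma scaleC_minus_right: "c *\<^sub>C (- x) = - (c *\<^sub>C (x :: 'a :: complex_inner))"
  by (metis scaleC_minus1 scaleC_scaleC mult.commute)

lemma scaleC_diff_right: "c *\<^sub>C (x - y) = c *\<^sub>C x - c *\<^sub>C (y :: 'a :: complex_inner)"
  using scaleC_add_right[of c x "- y"] by (simp add: scaleC_minus_right)

lemma cinner_sum_right: "cinner x (sum f F) = (\<Sum>i\<in>F. cinner x (f i :: 'a :: complex_inner))"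
  by (induction F rule: infinite_finite_induct) (auto simp: cinner_add_right)

lemma cinner_sum_left: "cinner (sum f F) x = (\<Sum>i\<in>F. cinner (f i :: 'a :: complex_inner) x)"
  by (induction F rule: infinite_finite_induct) (auto simp: cinner_add_left)

text \<open>Unless the inner product vanishes, multiplying \<open>y\<close> by a phase makes it real
  and nonnegative, so the real Cauchy-Schwarz inequality applies. This removes the factor 2 of
  \<open>norm_cinner_le\<close>.\<close>

lemma norm_cinner_Cauchy_Schwarz: "cmod (cinner x y) \<le> norm x * norm (y :: 'a :: complex_inner)"
proof -
  let ?c = "cnj (sgn (cinner x y))"
  have "?c * cinner x y = complex_of_real (cmod (cinner x y))"
    using complex_norm_square[of "cinner x y"]
    by (cases "cinner x y = 0")
      (simp_all add: sgn_div_norm scaleR_conv_of_real divide_simps mult.commute power2_eq_square)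
  hence "cmod (cinner x y) = inner x (?c *\<^sub>C y)"
    by (simp add: inner_eq_Re_cinner)
  also have "\<dots> \<le> norm x * (cmod ?c * norm y)"
    using norm_cauchy_schwarz[of x "?c *\<^sub>C y"] by simp
  also have "\<dots> \<le> norm x * norm y"
    by (cases "cinner x y = 0") (simp_all add: norm_sgn)
  finally show ?thesis .
qed

lemma bounded_linear_cinner_right: "bounded_linear (cinner (x :: 'a :: complex_inner))"
  by (rule bounded_linear_intro[where K = "norm x"])
    (simp_all add: cinner_add_right scaleR_scaleC scaleR_conv_of_real scaleC_complex_def
      norm_cinner_Cauchy_Schwarz mult.commute[of _ "norm x"])

lemma bounded_linear_cinner_left: "bounded_linear (\<lambda>x. cinner x (y :: 'a :: complex_inner))"
  by (rule bounded_linear_intro[where K = "norm y"])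
    (simp_all add: cinner_add_left scaleR_scaleC scaleR_conv_of_real scaleC_complex_def
      norm_cinner_Cauchy_Schwarz)

lemma cinner_eqI:
  assumes "\<And>x. cinner x y = cinner x (z :: 'a :: complex_inner)"
  shows "y = z"
  using assms[of "y - z"] cinner_self[of "y - z"] by (simp add: cinner_diff_right)

lemma norm_sq_eq_cinner: "(norm x)\<^sup>2 = Re (cinner x (x :: 'a :: complex_inner))"
  by (simp add: cinner_self)

lemma norm_diff_sq:
  "(norm (x - y))\<^sup>2 = Re (cinner x x) - 2 * Re (cinner x y) + Re (cinner y (y :: 'a :: complex_inner))"
  using cinner_commute[of x y]
  by (simp add: norm_sq_eq_cinner cinner_diff_right cinner_diff_left)

lemma bounded_clinear_bounded_linear: "bounded_clinear T \<Longrightarrow> bounded_linear T"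
  by (simp add: bounded_clinear_def)

lemma bounded_clinear_scaleC: "bounded_clinear T \<Longrightarrow> T (c *\<^sub>C x) = c *\<^sub>C T x"
  by (simp add: bounded_clinear_def)

lemma bounded_clinear_intro:
  assumes "\<And>x y. T (x + y) = T x + T y" "\<And>c x. T (c *\<^sub>C x) = c *\<^sub>C T x"
    and "\<And>x. norm (T x) \<le> K * norm x"
  shows "bounded_clinear T"
  unfolding bounded_clinear_def
  by (intro conjI bounded_linear_intro[where K = K]) (auto simp: assms scaleR_scaleC mult.commute)

lemma bounded_clinear_compose:
  assumes "bounded_clinear S" "bounded_clinear T"
  shows "bounded_clinear (\<lambda>x. S (T x))"
  using assms bounded_linear_compose[of S T] by (auto simp: bounded_clinear_def)

lemma bounded_clinear_diff:
  assumes "bounded_clinear S" "bounded_clinear T"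
  shows "bounded_clinear (\<lambda>x. S x - T x)"
  using assms bounded_linear_sub[of S T] by (auto simp: bounded_clinear_def scaleC_diff_right)

lemma bounded_clinear_ident: "bounded_clinear (\<lambda>x. x)"
  by (simp add: bounded_clinear_def)

text \<open>
  The representing vector minimises \<open>\<lambda>x. \<parallel>x\<parallel>\<^sup>2 - 2 * f x\<close>; by the parallelogram law a minimising
  sequence is Cauchy.
\<close>
lemma riesz_representation_real:
  fixes f :: "'a :: {real_inner, complete_space} \<Rightarrow> real"
  assumes "bounded_linear f"
  shows "\<exists>z. \<forall>x. f x = inner z x"
proof -
  interpret f: bounded_linear f by fact
  define \<phi> where "\<phi> x = (norm x)\<^sup>2 - 2 * f x" for x
  obtain K where K: "\<And>x. \<bar>f x\<bar> \<le> norm x * K" using f.bounded by auto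
  have lower: "- (K\<^sup>2) \<le> \<phi> x" for x
    using K[of x] zero_le_power2[of "norm x - K"] unfolding \<phi>_def power2_diff by linarith
  define m where "m = (INF x. \<phi> x)"
  have bdd: "bdd_below (range \<phi>)" using lower by (intro bdd_belowI) auto
  have m_le: "m \<le> \<phi> x" for x unfolding m_def by (rule cINF_lower[OF bdd]) simp
  have "\<exists>x. \<phi> x < m + 1 / real (Suc n)" for n
  proof (rule ccontr)
    assume "\<nexists>x. \<phi> x < m + 1 / real (Suc n)"
    hence "m + 1 / real (Suc n) \<le> m"
      unfolding m_def by (intro cINF_greatest) (auto simp: not_less m_def)
    thus False by simp
  qed
  then obtain X where X: "\<And>n. \<phi> (X n) < m + 1 / real (Suc n)" by metis
  have par: "(norm (x - y))\<^sup>2 = 2 * \<phi> x + 2 * \<phi> y - 4 * \<phi> ((1/2) *\<^sub>R (x + y))" for x y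
    unfolding \<phi>_def
    by (simp add: power2_norm_eq_inner f.scaleR f.add inner_simps algebra_simps inner_commute)
  have "Cauchy X"
  proof (rule CauchyI)
    fix e :: real assume "e > 0"
    obtain N where N: "4 / real (Suc N) < e\<^sup>2"
      using nat_approx_posE[of "e\<^sup>2 / 4"] \<open>e > 0\<close> by (auto simp: field_simps)
    have "norm (X i - X j) < e" if "i \<ge> N" "j \<ge> N" for i j
    proof -
      have le: "1 / real (Suc i) \<le> 1 / real (Suc N)" "1 / real (Suc j) \<le> 1 / real (Suc N)"
        using that by (auto intro!: divide_left_mono)
      have "(norm (X i - X j))\<^sup>2 < 4 / real (Suc N)"
        unfolding par using X[of i] X[of j] le m_le[of "(1/2) *\<^sub>R (X i + X j)"] by linarith
      hence "(norm (X i - X j))\<^sup>2 < e\<^sup>2" using N by linarith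
      thus ?thesis by (rule power2_less_imp_less) (use \<open>e > 0\<close> in simp)
    qed
    thus "\<exists>M. \<forall>i\<ge>M. \<forall>j\<ge>M. norm (X i - X j) < e" by blast
  qed
  then obtain z where z: "X \<longlonglongrightarrow> z" using Cauchy_convergent convergent_def by blast
  have "(\<lambda>n. \<phi> (X n)) \<longlonglongrightarrow> \<phi> z"
    unfolding \<phi>_def by (intro tendsto_intros f.tendsto z)
  moreover have "(\<lambda>n. m + 1 / real (Suc n)) \<longlonglongrightarrow> m + 0"
    by (intro tendsto_intros LIMSEQ_Suc[OF lim_1_over_n])
  ultimately have "\<phi> z \<le> m + 0"
    by (rule LIMSEQ_le) (use X less_imp_le in blast)
  hence min: "\<phi> z \<le> \<phi> x" for x using m_le[of x] by simp
  have "f x = inner z x" for x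
  proof (rule ccontr)
    assume ne: "f x \<noteq> inner z x"
    define a where "a = inner z x - f x"
    have "0 \<le> t * t * (norm x)\<^sup>2 + 2 * t * a" for t
      using min[of "z + t *\<^sub>R x"] unfolding \<phi>_def a_def
      by (simp add: power2_norm_eq_inner f.scaleR f.add inner_simps algebra_simps inner_commute)
    \<comment> \<open>At a minimiser the linear coefficient \<open>2 * a\<close> must vanish.
      Otherwise this \<open>t\<close> makes the quadratic negative; the \<open>+ 1\<close> keeps the
      denominator nonzero for every \<open>x\<close>.\<close>
    from this[of "- a / ((norm x)\<^sup>2 + 1)"]
    have "0 \<le> (a / ((norm x)\<^sup>2 + 1))\<^sup>2 * (norm x)\<^sup>2 - 2 * (a\<^sup>2 / ((norm x)\<^sup>2 + 1))"
      by (simp add: power2_eq_square)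
    also have "\<dots> = - (a\<^sup>2 * ((norm x)\<^sup>2 + 2) / ((norm x)\<^sup>2 + 1)\<^sup>2)"
    proof -
      have "(norm x)\<^sup>2 + 1 \<noteq> 0" using zero_le_power2[of "norm x"] by linarith
      thus ?thesis by (simp add: divide_simps) (simp add: power2_eq_square algebra_simps)
    qed
    finally have "a\<^sup>2 * ((norm x)\<^sup>2 + 2) / ((norm x)\<^sup>2 + 1)\<^sup>2 \<le> 0" by simp
    moreover have "0 < a\<^sup>2 * ((norm x)\<^sup>2 + 2) / ((norm x)\<^sup>2 + 1)\<^sup>2"
    proof -
      have "0 < a\<^sup>2" using ne by (simp add: a_def)
      moreover have "0 < (norm x)\<^sup>2 + 1" "0 < (norm x)\<^sup>2 + 2"
        using zero_le_power2[of "norm x"] by linarith+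
      ultimately show ?thesis by simp
    qed
    ultimately show False by linarith
  qed
  thus ?thesis by blast
qed

text \<open>The real representing vector of \<open>Re (f x)\<close> already works: evaluating at
  \<open>\<i> *\<^sub>C x\<close> turns real parts into imaginary parts.\<close>

lemma riesz_representation:
  fixes f :: "'a :: chilbert_space \<Rightarrow> complex"
  assumes "bounded_clinear f"
  shows "\<exists>z. \<forall>x. f x = cinner z x"
proof -
  have "bounded_linear (\<lambda>x. Re (f x))"
    using assms by (intro bounded_linear_compose[OF bounded_linear_Re]) (simp add: bounded_clinear_def)
  then obtain z where z: "\<And>x. Re (f x) = Re (cinner z x)"
    using riesz_representation_real inner_eq_Re_cinner by metis
  have "Im (f x) = Im (cinner z x)" for x
    using z[of "\<i> *\<^sub>C x"] assms by (simp add: bounded_clinear_def scaleC_complex_def)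
  with z show ?thesis by (auto simp: complex_eq_iff)
qed

text \<open>Uniqueness holds because \<open>w - z\<close> lies in \<open>S\<close> and can be tested
  against itself; this is what closure under differences is for. The rule evaluates the definite
  description in \<open>adj_on\<close>.\<close>

lemma adj_on_eqI:
  assumes z: "z \<in> S" and eq: "\<And>x. x \<in> S \<Longrightarrow> cinner x z = cinner (T x) y"
    and sub: "\<And>u v. u \<in> S \<Longrightarrow> v \<in> S \<Longrightarrow> u - v \<in> S"
  shows "adj_on S T y = (z :: 'a :: complex_inner)"
  unfolding adj_on_def
proof (rule the_equality)
  fix w assume w: "w \<in> S \<and> (\<forall>x\<in>S. cinner x w = cinner (T x) y)"
  hence "cinner (w - z) (w - z) = 0"
    using eq[of "w - z"] sub[of w z] z by (simp add: cinner_diff_right)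
  thus "w = z" by (simp add: cinner_self)
qed (use z eq in blast)

text \<open>Riesz representation, hence completeness of the domain, supplies the vector that the
  definite description asks for.\<close>

lemma cinner_adj_right:
  fixes T :: "'a :: chilbert_space \<Rightarrow> 'b :: complex_inner"
  assumes "bounded_clinear T"
  shows "cinner x (adj T y) = cinner (T x) y"
proof -
  have "bounded_clinear (\<lambda>x. cinner y (T x))"
    using bounded_linear_compose[OF bounded_linear_cinner_right bounded_clinear_bounded_linear[OF assms]]
      assms by (simp add: bounded_clinear_def scaleC_complex_def)
  then obtain z where z: "\<And>x. cinner y (T x) = cinner z x" using riesz_representation by blast
  have "cinner x z = cinner (T x) y" for x by (metis z cinner_commute)
  hence "adj T y = z" by (intro adj_on_eqI) auto
  thus ?thesis using \<open>cinner x z = cinner (T x) y\<close> by simp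
qed

lemma cinner_adj_left:
  fixes T :: "'a :: chilbert_space \<Rightarrow> 'b :: complex_inner"
  assumes "bounded_clinear T"
  shows "cinner (adj T y) x = cinner y (T x)"
  by (metis cinner_adj_right[OF assms] cinner_commute)

lemma adj_add:
  fixes T :: "'a :: chilbert_space \<Rightarrow> 'b :: complex_inner"
  assumes "bounded_clinear T"
  shows "adj T (x + y) = adj T x + adj T y"
  by (rule cinner_eqI) (simp add: cinner_adj_right[OF assms] cinner_add_right)

lemma adj_scaleC:
  fixes T :: "'a :: chilbert_space \<Rightarrow> 'b :: complex_inner"
  assumes "bounded_clinear T"
  shows "adj T (c *\<^sub>C x) = c *\<^sub>C adj T x"
  by (rule cinner_eqI) (simp add: cinner_adj_right[OF assms])

lemma bounded_clinear_adj:
  fixes T :: "'a :: chilbert_space \<Rightarrow> 'b :: complex_inner"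
  assumes T: "bounded_clinear T"
  shows "bounded_clinear (adj T)"
proof -
  obtain K where K: "K > 0" "\<And>x. norm (T x) \<le> norm x * K"
    using bounded_linear.pos_bounded[OF bounded_clinear_bounded_linear[OF T]] by blast
  have "norm (adj T y) \<le> K * norm y" for y
  proof (cases "adj T y = 0")
    case False
    have "(norm (adj T y))\<^sup>2 = Re (cinner (T (adj T y)) y)"
      by (simp add: norm_sq_eq_cinner cinner_adj_right[OF T])
    also have "\<dots> \<le> norm (T (adj T y)) * norm y"
      using complex_Re_le_cmod norm_cinner_Cauchy_Schwarz order_trans by blast
    also have "\<dots> \<le> norm (adj T y) * K * norm y"
      by (rule mult_right_mono[OF K(2)]) simp
    finally show ?thesis using False by (simp add: power2_eq_square mult.assoc)
  qed (use K(1) in simp)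
  thus ?thesis
    by (intro bounded_clinear_intro[where K = K]) (simp_all add: adj_add[OF T] adj_scaleC[OF T])
qed


section \<open>Orthogonal families of isometries\<close>

text \<open>The finite partial sums of \<open>g\<close> form a Cauchy net because their mutual
  distances are those of the convergent net for \<open>f\<close>; completeness of the target gives
  the limit.\<close>

lemma summable_on_isometric:
  fixes f :: "'i \<Rightarrow> 'a :: real_normed_vector" and g :: "'i \<Rightarrow> 'b :: {real_normed_vector, complete_space}"
  assumes f: "f summable_on A"
    and iso: "\<And>F G. finite F \<Longrightarrow> finite G \<Longrightarrow> F \<subseteq> A \<Longrightarrow> G \<subseteq> A \<Longrightarrow>
      norm (sum g F - sum g G) = norm (sum f F - sum f G)"
  shows "g summable_on A"
proof -
  obtain l where l: "(sum f \<longlongrightarrow> l) (finite_subsets_at_top A)"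
    using f unfolding summable_on_def has_sum_def by blast
  have "cauchy_filter (filtermap (sum g) (finite_subsets_at_top A))"
    unfolding cauchy_filter_metric_filtermap
  proof (intro allI impI)
    fix e :: real assume "e > 0"
    let ?P = "\<lambda>F. dist (sum f F) l < e / 2 \<and> finite F \<and> F \<subseteq> A"
    have "eventually (\<lambda>F. dist (sum f F) l < e / 2) (finite_subsets_at_top A)"
      using tendstoD[OF l, of "e / 2"] \<open>e > 0\<close> by simp
    moreover have "eventually (\<lambda>F. finite F \<and> F \<subseteq> A) (finite_subsets_at_top A)"
      by (rule eventually_finite_subsets_at_top_weakI) simp
    ultimately have "eventually ?P (finite_subsets_at_top A)" by (rule eventually_conj)
    moreover have "dist (sum g F) (sum g G) < e" if "?P F \<and> ?P G" for F G
      using that dist_triangle_half_l[of "sum f F" l e "sum f G"] iso[of F G]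
      by (simp add: dist_norm)
    ultimately show "\<exists>P. eventually P (finite_subsets_at_top A) \<and>
        (\<forall>F G. P F \<and> P G \<longrightarrow> dist (sum g F) (sum g G) < e)" by blast
  qed
  then obtain m where "(sum g \<longlongrightarrow> m) (finite_subsets_at_top A)"
    using cauchy_filter_complete_converges[of "filtermap (sum g) (finite_subsets_at_top A)" UNIV]
      complete_UNIV_cuspace[where 'a = 'b]
    by (auto simp: filtermap_bot_iff filterlim_def)
  thus ?thesis unfolding summable_on_def has_sum_def by blast
qed

lemma cinner_single [simp]: "cinner (single i x) y = cinner x (coord y i)"
proof -
  have "((\<lambda>j. cinner (coord (single i x) j) (coord y j)) has_sum cinner x (coord y i)) {i}"
    using has_sum_finite[of "{i}" "\<lambda>j. cinner (coord (single i x) j) (coord y j)"] by simp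
  also have "?this \<longleftrightarrow> ((\<lambda>j. cinner (coord (single i x) j) (coord y j)) has_sum cinner x (coord y i)) UNIV"
    by (rule has_sum_cong_neutral) auto
  finally show ?thesis using ell2_cinner_has_sum has_sum_unique by blast
qed

lemma cinner_single_right [simp]: "cinner y (single i x) = cinner (coord y i) x"
  by (metis cinner_single cinner_commute)

lemma cinner_single_single: "cinner (single i x) (single j y) = (if i = j then cinner x y else 0)"
  by simp

lemma single_has_sum: "((\<lambda>i. single i (coord x i)) has_sum x) UNIV"
  using tensor_expansion[of x] by (simp add: basis_tensor)

text \<open>Isometries with mutually orthogonal ranges, encoded by inner products alone.
  \<open>K\<close> is a set, so that the locale covers families on a whole space as well as a family
  considered on the kernel of a row operator.\<close>

locale orthogonal_isometries =
  fixes U :: "'i \<Rightarrow> 'a :: complex_inner \<Rightarrow> 'b :: chilbert_space" and K :: "'a set"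
  assumes cinner_U: "x \<in> K \<Longrightarrow> y \<in> K \<Longrightarrow> cinner (U i x) (U j y) = (if i = j then cinner x y else 0)"
begin

text \<open>The vectors \<open>U i (coord x i)\<close> have the same Gram matrix as the summands
  \<open>single i (coord x i)\<close> of \<open>x\<close>, hence partial sums at the same
  distances.\<close>

lemma summable:
  assumes "\<And>i. coord x i \<in> K"
  shows "(\<lambda>i. U i (coord x i)) summable_on UNIV"
proof (rule summable_on_isometric)
  show "(\<lambda>i. single i (coord x i)) summable_on UNIV"
    using single_has_sum summable_on_def by blast
next
  fix F G :: "'i set" assume [simp]: "finite F" "finite G"
  have "cinner (\<Sum>i\<in>F. U i (coord x i)) (\<Sum>i\<in>G. U i (coord x i)) =
      cinner (\<Sum>i\<in>F. single i (coord x i)) (\<Sum>i\<in>G. single i (coord x i))" for F G :: "'i set"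
    by (simp add: cinner_sum_left cinner_sum_right cinner_U assms cinner_single_single
        del: cinner_single cinner_single_right)
  hence "(norm ((\<Sum>i\<in>F. U i (coord x i)) - (\<Sum>i\<in>G. U i (coord x i))))\<^sup>2 =
      (norm ((\<Sum>i\<in>F. single i (coord x i)) - (\<Sum>i\<in>G. single i (coord x i))))\<^sup>2"
    by (simp only: norm_diff_sq)
  thus "norm ((\<Sum>i\<in>F. U i (coord x i)) - (\<Sum>i\<in>G. U i (coord x i))) =
      norm ((\<Sum>i\<in>F. single i (coord x i)) - (\<Sum>i\<in>G. single i (coord x i)))"
    by (simp add: power2_eq_iff_nonneg)
qed

definition total :: "('i, 'a) ell2 \<Rightarrow> 'b" where
  "total x = (\<Sum>\<^sub>\<infinity>i. U i (coord x i))"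

lemma has_sum_total:
  assumes "\<And>i. coord x i \<in> K"
  shows "((\<lambda>i. U i (coord x i)) has_sum total x) UNIV"
  unfolding total_def by (rule has_sum_infsum[OF summable[OF assms]])

text \<open>Pairing with the \<open>i\<close>-th range annihilates all other summands, so
  \<open>total x\<close> still determines the coordinates of \<open>x\<close>.\<close>

lemma cinner_U_total:
  assumes "u \<in> K" "\<And>i. coord x i \<in> K"
  shows "cinner (U i u) (total x) = cinner u (coord x i)"
proof -
  have "((\<lambda>j. cinner (U i u) (U j (coord x j))) has_sum cinner (U i u) (total x)) UNIV"
    by (rule has_sum_bounded_linear[OF bounded_linear_cinner_right has_sum_total[OF assms(2)]])
  moreover have "((\<lambda>j. cinner (U i u) (U j (coord x j))) has_sum cinner u (coord x i)) UNIV"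
  proof -
    have "((\<lambda>j. cinner (U i u) (U j (coord x j))) has_sum cinner u (coord x i)) {i}"
      using has_sum_finite[of "{i}" "\<lambda>j. cinner (U i u) (U j (coord x j))"] assms
      by (simp add: cinner_U)
    also have "?this \<longleftrightarrow> ((\<lambda>j. cinner (U i u) (U j (coord x j))) has_sum cinner u (coord x i)) UNIV"
      by (rule has_sum_cong_neutral) (auto simp: cinner_U assms)
    finally show ?thesis .
  qed
  ultimately show ?thesis by (rule has_sum_unique)
qed

lemma cinner_total:
  assumes "\<And>i. coord x i \<in> K" "\<And>i. coord y i \<in> K"
  shows "cinner (total x) (total y) = cinner x y"
proof -
  have "((\<lambda>i. cinner (U i (coord x i)) (total y)) has_sum cinner (total x) (total y)) UNIV"
    by (rule has_sum_bounded_linear[OF bounded_linear_cinner_left has_sum_total[OF assms(1)]])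
  thus ?thesis
    using ell2_cinner_has_sum[of x y] has_sum_unique by (simp add: cinner_U_total assms)
qed

end


section \<open>Projections and creation operators\<close>

text \<open>Polarisation: the quadratic form is real at \<open>x + y\<close> and at
  \<open>x + \<i> *\<^sub>C y\<close>, which settles the imaginary and the real part
  respectively.\<close>

lemma positive_op_selfadjoint:
  assumes "positive_op S"
  shows "cinner x (S y) = cinner (S x) y"
proof -
  have lin: "S (u + v) = S u + S v" "S (c *\<^sub>C u) = c *\<^sub>C S u" for u v c
    using assms bounded_linear.linear linear_add
    by (auto simp: positive_op_def bounded_clinear_def)
  have real: "Im (cinner z (S z)) = 0" for z
    using assms by (simp add: positive_op_def complex_nonneg_Reals_iff)
  have "Im (cinner x (S y)) = - Im (cinner y (S x))"
    using real[of "x + y"] real[of x] real[of y]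
    by (simp add: lin cinner_add_left cinner_add_right)
  moreover have "Re (cinner x (S y)) = Re (cinner y (S x))"
    using real[of "x + \<i> *\<^sub>C y"] real[of x] real[of y]
    by (simp add: lin cinner_add_left cinner_add_right)
  ultimately show ?thesis
    using cinner_commute[of "S x" y] by (simp add: complex_eq_iff)
qed

text \<open>Uniqueness of the positive square root \<open>S\<close> is checked on the kernel and on
  the range of \<open>P\<close>. On the kernel \<open>S\<close> vanishes, since \<open>S z\<close>
  has squared norm \<open>cinner z (P z)\<close>. On the range, \<open>y = S (P x) - P x\<close>
  satisfies \<open>S y = - y\<close>, which positivity allows only for \<open>y = 0\<close>.\<close>

lemma op_sqrt_projection:
  assumes P: "bounded_clinear P" and idem: "\<And>x. P (P x) = P x"
    and self: "\<And>x y. cinner x (P y) = cinner (P x) y"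
  shows "op_sqrt P = P"
  unfolding op_sqrt_def
proof (rule the_equality)
  have "cinner x (P x) = complex_of_real ((norm (P x))\<^sup>2)" for x
    by (metis idem self cinner_self)
  thus "positive_op P \<and> P \<circ> P = P"
    using P idem by (auto simp: positive_op_def complex_nonneg_Reals_iff)
next
  fix S assume S: "positive_op S \<and> S \<circ> S = P"
  hence SS: "S (S x) = P x" for x by (metis comp_apply)
  have pos: "0 \<le> Re (cinner z (S z))" for z
    using S by (simp add: positive_op_def complex_nonneg_Reals_iff)
  interpret S: bounded_linear S using S by (simp add: positive_op_def bounded_clinear_def)
  interpret P: bounded_linear P using P by (simp add: bounded_clinear_def)
  have "S x = P x" for x
  proof -
    have "cinner (S (x - P x)) (S (x - P x)) = cinner (x - P x) (P (x - P x))"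
      using positive_op_selfadjoint[of S "x - P x" "S (x - P x)"] S by (simp add: SS)
    also have "\<dots> = 0" by (simp add: P.diff idem)
    finally have ker: "S (x - P x) = 0" by (simp add: cinner_self)
    define y where "y = S (P x) - P x"
    have "S y = - y" by (simp add: y_def S.diff SS idem)
    hence "Re (cinner y y) \<le> 0" using pos[of y] by simp
    hence "y = 0" by (simp add: cinner_self)
    thus ?thesis using ker by (simp add: y_def S.diff)
  qed
  thus "S = P" by blast
qed

section \<open>Coordinates, words and creation operators\<close>

lemma coord_Abs_ell2: "(\<lambda>i. (norm (f i))\<^sup>2) summable_on UNIV \<Longrightarrow> coord (Abs_ell2 f) = f"
  by (simp add: Abs_ell2_inverse)

lemma bounded_clinear_coord: "bounded_clinear (\<lambda>x. coord x i)"
  by (rule bounded_clinear_intro[where K = 1]) (simp_all add: norm_coord_le)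

lemma word_op_Nil [simp]: "word_op T [] = id"
  and word_op_Cons [simp]: "word_op T (i # \<alpha>) = T i \<circ> word_op T \<alpha>"
  by (simp_all add: word_op_def)

text \<open>Only words starting with \<open>i\<close> carry nonzero coordinates, and prepending
  \<open>i\<close> reindexes them by all words. As \<open>f\<close> may depend on the word, this
  serves both inner products and sums over word operators.\<close>

lemma creation_has_sum:
  assumes "((\<lambda>\<beta>. f (i # \<beta>) (coord \<xi> \<beta>)) has_sum s) UNIV" "\<And>\<alpha>. f \<alpha> 0 = 0"
  shows "((\<lambda>\<alpha>. f \<alpha> (coord (creation i \<xi>) \<alpha>)) has_sum s) UNIV"
proof -
  have "((\<lambda>\<alpha>. f \<alpha> (coord (creation i \<xi>) \<alpha>)) has_sum s) (range ((#) i))"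
    using assms(1) by (subst has_sum_reindex) (auto simp: o_def creation.rep_eq)
  also have "?this \<longleftrightarrow> ?thesis"
    by (rule has_sum_cong_neutral) (auto simp: creation.rep_eq assms(2) split: list.splits)
  finally show ?thesis .
qed

lemma coord_creation_Nil [simp]: "coord (creation i \<xi>) [] = 0"
  and coord_creation_Cons [simp]: "coord (creation i \<xi>) (j # \<alpha>) = (if j = i then coord \<xi> \<alpha> else 0)"
  by (simp_all add: creation.rep_eq)

lemma cinner_creation: "cinner (creation i \<xi>) (creation j \<eta>) = (if i = j then cinner \<xi> \<eta> else 0)"
proof -
  have "((\<lambda>\<beta>. cinner (coord \<xi> \<beta>) (coord (creation j \<eta>) (i # \<beta>))) has_sum
      (if i = j then cinner \<xi> \<eta> else 0)) UNIV"
    using ell2_cinner_has_sum[of \<xi> \<eta>] by simp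
  hence "((\<lambda>\<alpha>. cinner (coord (creation i \<xi>) \<alpha>) (coord (creation j \<eta>) \<alpha>)) has_sum
      (if i = j then cinner \<xi> \<eta> else 0)) UNIV"
    by (intro creation_has_sum[where f = "\<lambda>\<alpha> x. cinner x (coord (creation j \<eta>) \<alpha>)"]) auto
  thus ?thesis using ell2_cinner_has_sum has_sum_unique by blast
qed

lemma creation_add: "creation i (\<xi> + \<eta>) = creation i \<xi> + creation i \<eta>"
  and creation_scaleC: "creation i (c *\<^sub>C \<xi>) = c *\<^sub>C creation i \<xi>"
  by (rule ell2_eqI, simp add: creation.rep_eq split: list.splits)+

lemma single_add: "single i (x + y) = single i x + single i y"
  and single_scaleC: "single i (c *\<^sub>C x) = c *\<^sub>C single i x"
  by (rule ell2_eqI, simp)+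

lemma single_zero [simp]: "single i 0 = 0"
  by (rule ell2_eqI) simp

lemma (in orthogonal_isometries) total_add:
  assumes "\<And>i. coord x i \<in> K" "\<And>i. coord y i \<in> K" "\<And>i. coord (x + y) i \<in> K"
    and "\<And>i x y. x \<in> K \<Longrightarrow> y \<in> K \<Longrightarrow> U i (x + y) = U i x + U i y"
  shows "total (x + y) = total x + total y"
  using has_sum_add[OF has_sum_total[OF assms(1)] has_sum_total[OF assms(2)]]
    has_sum_total[OF assms(3)] by (simp add: assms has_sum_unique)

lemma bounded_clinear_scaleC_fun: "bounded_clinear (\<lambda>x. c *\<^sub>C (x :: 'a :: complex_inner))"
  by (rule bounded_clinear_intro[where K = "cmod c"]) (simp_all add: scaleC_add_right mult.commute)

lemma (in orthogonal_isometries) total_scaleC: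
  assumes "\<And>i. coord x i \<in> K" "\<And>i. coord (c *\<^sub>C x) i \<in> K"
    and "\<And>i x. x \<in> K \<Longrightarrow> U i (c *\<^sub>C x) = c *\<^sub>C U i x"
  shows "total (c *\<^sub>C x) = c *\<^sub>C total x"
  using has_sum_bounded_linear[OF bounded_clinear_bounded_linear[OF bounded_clinear_scaleC_fun]
      has_sum_total[OF assms(1)], of c]
    has_sum_total[OF assms(2)] by (simp add: assms has_sum_unique)

lemma (in orthogonal_isometries) total_single:
  assumes "\<And>j. U j 0 = 0"
  shows "total (single i x) = U i x"
proof -
  have "((\<lambda>j. U j (coord (single i x) j)) has_sum U i x) {i}"
    using has_sum_finite[of "{i}" "\<lambda>j. U j (coord (single i x) j)"] by simp
  also have "?this \<longleftrightarrow> ((\<lambda>j. U j (coord (single i x) j)) has_sum U i x) UNIV"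
    by (rule has_sum_cong_neutral) (auto simp: assms)
  finally show ?thesis unfolding total_def by (rule infsumI)
qed


section \<open>Coisometric rows and their isometric dilation\<close>

locale coisometric_row =
  fixes A :: "'d \<Rightarrow> 'h :: chilbert_space \<Rightarrow> 'h"
  assumes row_contraction: "row_contraction A" and coisometric: "coisometric A"
begin

lemma bounded_clinear_A: "bounded_clinear (A i)"
  using row_contraction by (simp add: row_contraction_def)

sublocale A: bounded_linear "A i" for i
  by (rule bounded_clinear_bounded_linear[OF bounded_clinear_A])

sublocale adj: bounded_linear "adj (A i)" for i
  by (rule bounded_clinear_bounded_linear[OF bounded_clinear_adj[OF bounded_clinear_A]])

lemmas A_scaleC = bounded_clinear_scaleC[OF bounded_clinear_A]
lemmas adj_A_scaleC = adj_scaleC[OF bounded_clinear_A]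
lemmas cinner_A_adj_right = cinner_adj_right[OF bounded_clinear_A]
lemmas cinner_A_adj_left = cinner_adj_left[OF bounded_clinear_A]

lemma cinner_adj_has_sum: "((\<lambda>i. cinner (adj (A i) g) (adj (A i) h)) has_sum cinner g h) UNIV"
proof -
  have "((\<lambda>i. cinner g (A i (adj (A i) h))) has_sum cinner g h) UNIV"
    by (rule has_sum_bounded_linear[OF bounded_linear_cinner_right])
      (use coisometric coisometric_def in blast)
  thus ?thesis by (simp add: cinner_A_adj_left)
qed

lemma norm_adj_sq_has_sum: "((\<lambda>i. (norm (adj (A i) h))\<^sup>2) has_sum (norm h)\<^sup>2) UNIV"
  using has_sum_Re[OF cinner_adj_has_sum[of h h]] by (simp add: norm_sq_eq_cinner)

text \<open>The adjoint of the row operator, see \<open>adj_row\<close>. Coisometry makes the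
  squared norms of the coordinates sum to that of \<open>h\<close>, so they do form an element of
  the direct sum.\<close>

definition col :: "'h \<Rightarrow> ('d, 'h) ell2" where
  "col h = Abs_ell2 (\<lambda>i. adj (A i) h)"

lemma coord_col [simp]: "coord (col h) i = adj (A i) h"
  unfolding col_def by (subst coord_Abs_ell2) (use norm_adj_sq_has_sum summable_on_def in blast, simp)

lemma cinner_col: "cinner (col g) (col h) = cinner g h"
  using ell2_cinner_has_sum[of "col g" "col h"] cinner_adj_has_sum[of g h] has_sum_unique by simp

lemma row_has_sum: "((\<lambda>i. A i (coord x i)) has_sum row A x) UNIV"
  using row_contraction by (simp add: row_contraction_def row_def)

lemma norm_row_le: "norm (row A x) \<le> norm x"
  using row_contraction by (simp add: row_contraction_def)

lemma cinner_row: "cinner h (row A x) = cinner (col h) x"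
  using has_sum_bounded_linear[OF bounded_linear_cinner_right row_has_sum, of h x]
    ell2_cinner_has_sum[of "col h" x] by (simp add: cinner_A_adj_left has_sum_unique)

lemma bounded_clinear_row: "bounded_clinear (row A)"
proof (rule bounded_clinear_intro[where K = 1])
  show "row A (x + y) = row A x + row A y" for x y
    by (rule cinner_eqI) (simp add: cinner_row cinner_add_right)
  show "row A (c *\<^sub>C x) = c *\<^sub>C row A x" for c x
    by (rule cinner_eqI) (simp add: cinner_row)
qed (simp add: norm_row_le)

sublocale row: bounded_linear "row A"
  by (rule bounded_clinear_bounded_linear[OF bounded_clinear_row])

lemma row_col [simp]: "row A (col h) = h"
  by (rule cinner_eqI) (simp add: cinner_row cinner_col)

lemma adj_row: "adj (row A) h = col h"
proof (rule adj_on_eqI)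
  show "cinner x (col h) = cinner (row A x) h" for x
    by (metis cinner_row cinner_commute)
qed auto

lemma cinner_col_right: "cinner x (col h) = cinner (row A x) h"
  by (metis cinner_row cinner_commute)

lemma bounded_clinear_col: "bounded_clinear col"
  using bounded_clinear_adj[OF bounded_clinear_row] by (simp add: adj_row[abs_def])

sublocale col: bounded_linear col
  by (rule bounded_clinear_bounded_linear[OF bounded_clinear_col])

text \<open>Since \<open>row A\<close> is a left inverse of the isometry \<open>col\<close> and
  \<open>col\<close> is its adjoint, \<open>col \<circ> row A\<close> is an orthogonal projection.
  So is its complement, and a projection is its own positive square root.\<close>

lemma defect_op_eq: "defect_op A x = x - col (row A x)"
proof -
  have "op_sqrt (\<lambda>x. x - col (row A x)) = (\<lambda>x. x - col (row A x))"
  proof (rule op_sqrt_projection)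
    show "bounded_clinear (\<lambda>x. x - col (row A x))"
      by (intro bounded_clinear_diff bounded_clinear_ident
          bounded_clinear_compose[OF bounded_clinear_col bounded_clinear_row])
  qed (simp_all add: row.diff cinner_diff_left cinner_diff_right cinner_col_right flip: cinner_row)
  thus ?thesis by (simp add: defect_op_def adj_row)
qed

text \<open>The vectors in the kernel are those fixed by the projection. Membership in the defect
  space thus becomes a linear equation.\<close>

lemma defect_space_eq: "defect_space A = {x. row A x = 0}"
proof
  show "defect_space A \<subseteq> {x. row A x = 0}"
    by (auto simp: defect_space_def defect_op_eq row.diff)
  show "{x. row A x = 0} \<subseteq> defect_space A"
  proof
    fix x assume "x \<in> {x. row A x = 0}"
    hence "x = defect_op A x" by (simp add: defect_op_eq col.zero)
    thus "x \<in> defect_space A" unfolding defect_space_def by (rule range_eqI)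
  qed
qed

lemma bounded_clinear_defect_op: "bounded_clinear (defect_op A)"
  unfolding defect_op_eq[abs_def]
  by (intro bounded_clinear_diff bounded_clinear_ident
      bounded_clinear_compose[OF bounded_clinear_col bounded_clinear_row])

sublocale defect_op: bounded_linear "defect_op A"
  by (rule bounded_clinear_bounded_linear[OF bounded_clinear_defect_op])

lemma row_single [simp]: "row A (single i h) = A i h"
proof (rule cinner_eqI)
  show "cinner x (row A (single i h)) = cinner x (A i h)" for x
    by (simp add: cinner_row cinner_A_adj_left)
qed

lemma defect_vec_eq: "defect_vec A i h = single i h - col (A i h)"
  by (simp add: defect_vec_def defect_op_eq)

lemma coord_defect_vec:
  "coord (defect_vec A i h) j = (if j = i then h else 0) - adj (A j) (A i h)"
  by (simp add: defect_vec_eq)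

lemma defect_vec_in_defect_space: "defect_vec A i h \<in> defect_space A"
  by (simp add: defect_vec_def defect_space_def)

lemma defect_vec_add: "defect_vec A i (g + h) = defect_vec A i g + defect_vec A i h"
  by (simp add: defect_vec_def single_add defect_op.add)

lemma defect_vec_scaleC: "defect_vec A i (c *\<^sub>C h) = c *\<^sub>C defect_vec A i h"
  by (simp add: defect_vec_def single_scaleC bounded_clinear_scaleC[OF bounded_clinear_defect_op])

text \<open>The correction \<open>col (A i h)\<close> is orthogonal to the kernel of
  \<open>row A\<close>, so pairing with a defect vector reads off a coordinate.\<close>

lemma cinner_defect_vec_left:
  assumes "row A x = 0"
  shows "cinner (defect_vec A i h) x = cinner h (coord x i)"
  using assms by (simp add: defect_vec_eq cinner_diff_left flip: cinner_row)

lemma cinner_defect_vec: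
  "cinner (defect_vec A i g) (defect_vec A j h) =
    (if i = j then cinner g h else 0) - cinner (A i g) (A j h)"
proof -
  have "row A (defect_vec A j h) = 0" by (simp add: defect_vec_eq row.diff)
  thus ?thesis
    by (simp add: cinner_defect_vec_left coord_defect_vec cinner_diff_right cinner_A_adj_right)
qed

section \<open>The isometric dilation of a coisometric row\<close>

lemma dilation_space_iff: "u \<in> dilation_space A \<longleftrightarrow> (\<forall>\<alpha>. row A (coord (snd u) \<alpha>) = 0)"
  by (cases u) (simp add: dilation_space_def fock_tensor_def defect_space_eq)

lemma dilation_add: "dilation A i (u + v) = dilation A i u + dilation A i v"
  by (cases u; cases v)
    (simp add: dilation_def A.add defect_vec_add creation_add basis_tensor single_add)

lemma dilation_scaleC: "dilation A i (c *\<^sub>C u) = c *\<^sub>C dilation A i u"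
  by (cases u)
    (simp add: dilation_def A_scaleC defect_vec_scaleC creation_scaleC basis_tensor single_scaleC
      scaleC_prod_def scaleC_add_right)

text \<open>The defect vectors contribute exactly the term that cancels the inner product of the
  first components; vacuum and created vectors are orthogonal.\<close>

lemma cinner_dilation: "cinner (dilation A i u) (dilation A j v) = (if i = j then cinner u v else 0)"
  by (cases u; cases v)
    (simp add: dilation_def cinner_prod_def cinner_add_left cinner_add_right basis_tensor
      cinner_creation cinner_defect_vec)

lemma bounded_clinear_dilation: "bounded_clinear (dilation A i)"
proof (rule bounded_clinear_intro[where K = 1])
  have "(norm (dilation A i u))\<^sup>2 = (norm u)\<^sup>2" for u
    by (simp add: norm_sq_eq_cinner cinner_dilation)
  thus "norm (dilation A i u) \<le> 1 * norm u" for u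
    by (metis mult_1 norm_ge_zero power2_le_imp_le order_refl)
qed (simp_all add: dilation_add dilation_scaleC)

end


section \<open>Extending an isometric intertwiner to the dilation\<close>

text \<open>The extension problem in abstract form. The last assumption says that the adjoint of
  \<open>S i\<close> maps \<open>T h\<close> to \<open>T (adj (A i) h)\<close>, phrased with inner
  products only.\<close>

locale isometric_intertwiner = coisometric_row A
  for A :: "'d \<Rightarrow> 'h :: chilbert_space \<Rightarrow> 'h" +
  fixes S :: "'d \<Rightarrow> 'k :: chilbert_space \<Rightarrow> 'k" and T :: "'h \<Rightarrow> 'k"
  assumes bounded_clinear_S: "bounded_clinear (S i)"
    and cinner_S: "cinner (S i x) (S j y) = (if i = j then cinner x y else 0)"
    and bounded_clinear_T: "bounded_clinear T"
    and cinner_T: "cinner (T g) (T h) = cinner g h"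
    and cinner_S_T: "cinner (S i x) (T h) = cinner x (T (adj (A i) h))"
begin

sublocale S: bounded_linear "S i" for i
  by (rule bounded_clinear_bounded_linear[OF bounded_clinear_S])

sublocale T: bounded_linear T
  by (rule bounded_clinear_bounded_linear[OF bounded_clinear_T])

lemmas S_scaleC = bounded_clinear_scaleC[OF bounded_clinear_S]
lemmas T_scaleC = bounded_clinear_scaleC[OF bounded_clinear_T]

lemma bounded_clinear_word_S: "bounded_clinear (word_op S \<alpha>)"
proof (induction \<alpha>)
  case (Cons i \<alpha>)
  thus ?case using bounded_clinear_compose[OF bounded_clinear_S] by (simp add: o_def)
qed (simp add: bounded_clinear_ident id_def)

sublocale word_S: bounded_linear "word_op S \<alpha>" for \<alpha>
  by (rule bounded_clinear_bounded_linear[OF bounded_clinear_word_S])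

sublocale ST: orthogonal_isometries "\<lambda>i h. S i (T h)" UNIV
  by standard (simp add: cinner_S cinner_T)

abbreviation \<Phi> :: "('d, 'h) ell2 \<Rightarrow> 'k" where
  "\<Phi> \<equiv> ST.total"

lemma \<Phi>_add: "\<Phi> (x + y) = \<Phi> x + \<Phi> y"
  by (rule ST.total_add) (simp_all add: S.add T.add)

lemma \<Phi>_scaleC: "\<Phi> (c *\<^sub>C x) = c *\<^sub>C \<Phi> x"
  by (rule ST.total_scaleC) (simp_all add: S_scaleC T_scaleC)

lemma \<Phi>_zero: "\<Phi> 0 = 0"
  using \<Phi>_scaleC[of 0 0] by simp

lemma \<Phi>_diff: "\<Phi> (x - y) = \<Phi> x - \<Phi> y"
  using \<Phi>_add[of "x - y" y] by simp

lemma \<Phi>_single: "\<Phi> (single i h) = S i (T h)"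
  by (rule ST.total_single) (simp_all add: S.zero T.zero)

text \<open>The adjoint of \<open>T\<close> composed with \<open>\<Phi>\<close> is
  \<open>row A\<close>. Hence \<open>\<Phi>\<close> maps the defect space into the orthogonal
  complement of the range of \<open>T\<close>.\<close>

lemma cinner_\<Phi>_T: "cinner (\<Phi> x) (T h) = cinner (row A x) h"
proof -
  have "((\<lambda>i. cinner (S i (T (coord x i))) (T h)) has_sum cinner (\<Phi> x) (T h)) UNIV"
    by (rule has_sum_bounded_linear[OF bounded_linear_cinner_left ST.has_sum_total]) simp
  hence "((\<lambda>i. cinner (coord x i) (coord (col h) i)) has_sum cinner (\<Phi> x) (T h)) UNIV"
    by (simp add: cinner_S_T cinner_T)
  thus ?thesis
    using ell2_cinner_has_sum[of x "col h"] has_sum_unique by (simp add: cinner_col_right)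
qed

text \<open>The squared distance expands into multiples of \<open>cinner h h\<close> that cancel. In
  other words, \<open>T h\<close> is the sum of the \<open>S i (T (adj (A i) h))\<close>.\<close>

lemma \<Phi>_col: "\<Phi> (col h) = T h"
proof -
  have "cinner (T h) (\<Phi> (col h)) = cinner h h"
    by (metis cinner_\<Phi>_T cinner_commute row_col)
  hence "(norm (\<Phi> (col h) - T h))\<^sup>2 = 0"
    unfolding norm_diff_sq by (simp add: ST.cinner_total cinner_T cinner_\<Phi>_T cinner_col)
  thus ?thesis by simp
qed

lemma \<Phi>_defect_vec: "\<Phi> (defect_vec A i h) = S i (T h) - T (A i h)"
  by (simp add: defect_vec_eq \<Phi>_diff \<Phi>_single \<Phi>_col)

lemma cinner_\<Phi>_S: "cinner (\<Phi> x) (S i k) = cinner (T (coord x i)) k"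
proof -
  have "((\<lambda>j. cinner (S j (T (coord x j))) (S i k)) has_sum cinner (\<Phi> x) (S i k)) UNIV"
    by (rule has_sum_bounded_linear[OF bounded_linear_cinner_left ST.has_sum_total]) simp
  moreover have "((\<lambda>j. cinner (S j (T (coord x j))) (S i k)) has_sum cinner (T (coord x i)) k) UNIV"
  proof -
    have "((\<lambda>j. cinner (S j (T (coord x j))) (S i k)) has_sum cinner (T (coord x i)) k) {i}"
      using has_sum_finite[of "{i}" "\<lambda>j. cinner (S j (T (coord x j))) (S i k)"]
      by (simp add: cinner_S)
    also have "?this \<longleftrightarrow>
        ((\<lambda>j. cinner (S j (T (coord x j))) (S i k)) has_sum cinner (T (coord x i)) k) UNIV"
      by (rule has_sum_cong_neutral) (auto simp: cinner_S)
    finally show ?thesis .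
  qed
  ultimately show ?thesis by (rule has_sum_unique)
qed

text \<open>Each letter is moved across the inner product and turns \<open>h\<close> into
  \<open>adj (A i) h\<close>, hence the generalisation over \<open>h\<close>; the empty word reduces
  to \<open>row A x = 0\<close>.\<close>

lemma cinner_T_word:
  assumes "row A x = 0"
  shows "cinner (T h) (word_op S \<alpha> (\<Phi> x)) = 0"
proof (induction \<alpha> arbitrary: h)
  case Nil
  thus ?case using assms cinner_\<Phi>_T[of x h] cinner_commute[of "T h" "\<Phi> x"] by simp
next
  case (Cons i \<alpha>)
  thus ?case
    using cinner_S_T[of i "word_op S \<alpha> (\<Phi> x)" h]
      cinner_commute[of "S i (word_op S \<alpha> (\<Phi> x))" "T h"]
      cinner_commute[of "T (adj (A i) h)" "word_op S \<alpha> (\<Phi> x)"] by (simp add: complex_eq_iff)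
qed

text \<open>The image of the defect space under \<open>\<Phi>\<close> is a wandering subspace for
  \<open>S\<close>. Equal first letters cancel, different ones give orthogonality, and a nonempty
  word against the empty one reduces to \<open>cinner_T_word\<close>.\<close>

sublocale \<Psi>: orthogonal_isometries "\<lambda>\<alpha> x. word_op S \<alpha> (\<Phi> x)" "{x. row A x = 0}"
proof
  fix x y :: "('d, 'h) ell2" and \<alpha> \<beta>
  assume "x \<in> {x. row A x = 0}" "y \<in> {x. row A x = 0}"
  hence x: "row A x = 0" and y: "row A y = 0" by auto
  show "cinner (word_op S \<alpha> (\<Phi> x)) (word_op S \<beta> (\<Phi> y)) = (if \<alpha> = \<beta> then cinner x y else 0)"
  proof (induction \<alpha> arbitrary: \<beta>)
    case Nil
    show ?case
      by (cases \<beta>) (simp_all add: ST.cinner_total cinner_\<Phi>_S cinner_T_word[OF y])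
  next
    case (Cons i \<alpha>)
    show ?case
    proof (cases \<beta>)
      case Nil
      have "cinner (\<Phi> y) (S i (word_op S \<alpha> (\<Phi> x))) = 0"
        by (simp add: cinner_\<Phi>_S cinner_T_word[OF x])
      thus ?thesis using Nil cinner_commute[of "S i (word_op S \<alpha> (\<Phi> x))" "\<Phi> y"] by simp
    next
      case (Cons j \<gamma>)
      thus ?thesis using Cons.IH[of \<gamma>] by (cases "\<alpha> = \<gamma>") (simp_all add: cinner_S)
    qed
  qed
qed

section \<open>The extension of \<open>T\<close> to the dilation space\<close>

definition W :: "'h \<times> ('d list, ('d, 'h) ell2) ell2 \<Rightarrow> 'k" where
  "W = (\<lambda>(h, \<xi>). T h + \<Psi>.total \<xi>)"

lemma cinner_T_\<Psi>:
  assumes "\<And>\<alpha>. row A (coord \<xi> \<alpha>) = 0"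
  shows "cinner (T h) (\<Psi>.total \<xi>) = 0"
proof -
  have "((\<lambda>\<alpha>. cinner (T h) (word_op S \<alpha> (\<Phi> (coord \<xi> \<alpha>)))) has_sum cinner (T h) (\<Psi>.total \<xi>)) UNIV"
    by (rule has_sum_bounded_linear[OF bounded_linear_cinner_right \<Psi>.has_sum_total])
      (simp add: assms)
  from infsumI[OF this] show ?thesis by (simp add: cinner_T_word assms)
qed

lemma cinner_W:
  assumes "u \<in> dilation_space A" "v \<in> dilation_space A"
  shows "cinner (W u) (W v) = cinner u v"
proof -
  obtain g \<xi> h \<eta> where uv: "u = (g, \<xi>)" "v = (h, \<eta>)" by (cases u; cases v) blast
  have \<xi>: "\<And>\<alpha>. row A (coord \<xi> \<alpha>) = 0" and \<eta>: "\<And>\<alpha>. row A (coord \<eta> \<alpha>) = 0"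
    using assms by (auto simp: dilation_space_iff uv)
  have "cinner (\<Psi>.total \<xi>) (T h) = 0"
    using cinner_T_\<Psi>[OF \<xi>, of h] cinner_commute[of "\<Psi>.total \<xi>" "T h"] by simp
  thus ?thesis
    by (simp add: uv W_def cinner_prod_def cinner_add_left cinner_add_right cinner_T
        cinner_T_\<Psi>[OF \<eta>] \<Psi>.cinner_total \<xi> \<eta>)
qed

lemma \<Psi>_add:
  assumes "\<And>\<alpha>. row A (coord \<xi> \<alpha>) = 0" "\<And>\<alpha>. row A (coord \<eta> \<alpha>) = 0"
  shows "\<Psi>.total (\<xi> + \<eta>) = \<Psi>.total \<xi> + \<Psi>.total \<eta>"
  by (rule \<Psi>.total_add) (simp_all add: assms \<Phi>_add word_S.add row.add)

lemma W_add:
  assumes "u \<in> dilation_space A" "v \<in> dilation_space A"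
  shows "W (u + v) = W u + W v"
  using assms by (cases u; cases v) (simp add: W_def T.add dilation_space_iff \<Psi>_add)

lemma W_scaleC:
  assumes "u \<in> dilation_space A"
  shows "W (c *\<^sub>C u) = c *\<^sub>C W u"
proof -
  obtain h \<xi> where u: "u = (h, \<xi>)" by (cases u)
  have "\<Psi>.total (c *\<^sub>C \<xi>) = c *\<^sub>C \<Psi>.total \<xi>"
    using assms by (intro \<Psi>.total_scaleC)
      (simp_all add: u dilation_space_iff \<Phi>_scaleC bounded_clinear_scaleC[OF bounded_clinear_word_S]
        bounded_clinear_scaleC[OF bounded_clinear_row])
  thus ?thesis by (simp add: u W_def scaleC_prod_def T_scaleC scaleC_add_right)
qed

lemma \<Psi>_vacuum:
  assumes "row A x = 0"
  shows "\<Psi>.total (vacuum \<otimes> x) = \<Phi> x"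
  unfolding basis_tensor using \<Psi>.total_single[of "[]" x] assms
  by (simp add: row.zero \<Phi>_zero word_S.zero)

lemma \<Psi>_creation:
  assumes "\<And>\<alpha>. row A (coord \<xi> \<alpha>) = 0"
  shows "\<Psi>.total (creation i \<xi>) = S i (\<Psi>.total \<xi>)"
proof -
  have "((\<lambda>\<beta>. word_op S (i # \<beta>) (\<Phi> (coord \<xi> \<beta>))) has_sum S i (\<Psi>.total \<xi>)) UNIV"
    using has_sum_bounded_linear[OF S.bounded_linear_axioms \<Psi>.has_sum_total[of \<xi>], of i] assms
    by simp
  hence "((\<lambda>\<alpha>. word_op S \<alpha> (\<Phi> (coord (creation i \<xi>) \<alpha>))) has_sum S i (\<Psi>.total \<xi>)) UNIV"
    by (rule creation_has_sum[where f = "\<lambda>\<alpha> x. word_op S \<alpha> (\<Phi> x)"]) (simp add: \<Phi>_zero word_S.zero)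
  thus ?thesis unfolding \<Psi>.total_def by (rule infsumI)
qed

text \<open>The summand \<open>- T (A i h)\<close> of \<open>\<Phi> (defect_vec A i h)\<close>
  cancels the image of the base component and leaves \<open>S i (T h)\<close>.\<close>

lemma W_dilation:
  assumes "u \<in> dilation_space A"
  shows "W (dilation A i u) = S i (W u)"
proof -
  obtain h \<xi> where u: "u = (h, \<xi>)" by (cases u)
  have \<xi>: "\<And>\<alpha>. row A (coord \<xi> \<alpha>) = 0" using assms by (simp add: u dilation_space_iff)
  have d: "row A (defect_vec A i h) = 0" using defect_vec_in_defect_space defect_space_eq by blast
  have "\<Psi>.total (vacuum \<otimes> defect_vec A i h + creation i \<xi>) =
      \<Psi>.total (vacuum \<otimes> defect_vec A i h) + \<Psi>.total (creation i \<xi>)"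
    by (rule \<Psi>_add)
      (auto simp: basis_tensor d row.zero creation.rep_eq \<xi> split: list.splits)
  thus ?thesis
    by (simp add: u W_def dilation_def \<Psi>_vacuum[OF d] \<Psi>_creation[OF \<xi>] \<Phi>_defect_vec S.add)
qed

lemma W_vacuum:
  assumes "row A x = 0"
  shows "W (0, vacuum \<otimes> x) = \<Phi> x"
  by (simp add: W_def T.zero \<Psi>_vacuum[OF assms])

lemma \<Psi>_zero: "\<Psi>.total 0 = 0"
  using \<Psi>_vacuum[of 0] by (simp add: row.zero \<Phi>_zero basis_tensor single_zero)

lemma W_base: "W (h, 0) = T h"
  by (simp add: W_def \<Psi>_zero)

end


section \<open>The scalar row\<close>

lemma bounded_clinear_scalar_row: "bounded_clinear (scalar_row \<omega> i)"
  by (rule bounded_clinear_intro[where K = "cmod (coord \<omega> i)"])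
    (simp_all add: scalar_row_def scaleC_complex_def norm_mult algebra_simps)

lemma scalar_row_has_sum:
  "((\<lambda>i. scalar_row \<omega> i (coord x i)) has_sum cinner (cnj_ell2 \<omega>) x) UNIV"
  using ell2_cinner_has_sum[of "cnj_ell2 \<omega>" x] by (simp add: scalar_row_def cinner_complex_def)

lemma row_scalar_row: "row (scalar_row \<omega>) x = cinner (cnj_ell2 \<omega>) x"
  unfolding row_def by (rule infsumI[OF scalar_row_has_sum])

lemma adj_scalar_row: "adj (scalar_row \<omega> i) z = cnj (coord \<omega> i) * z"
  by (rule adj_on_eqI) (simp_all add: scalar_row_def cinner_complex_def)

lemma norm_cnj_ell2_eq_1:
  assumes "((\<lambda>i. (cmod (coord \<omega> i))\<^sup>2) has_sum 1) UNIV"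
  shows "norm (cnj_ell2 \<omega>) = 1"
proof -
  have "((\<lambda>i. (cmod (coord \<omega> i))\<^sup>2) has_sum (norm (cnj_ell2 \<omega>))\<^sup>2) UNIV"
    using ell2_norm_sq_has_sum[of "cnj_ell2 \<omega>"] by simp
  hence "(norm (cnj_ell2 \<omega>))\<^sup>2 = 1\<^sup>2"
    using has_sum_unique[OF _ assms] by simp
  thus ?thesis by (simp only: power2_eq_iff_nonneg norm_ge_zero zero_le_one)
qed

text \<open>Contractivity is Cauchy-Schwarz against the unit vector
  \<open>cnj_ell2 \<omega>\<close>, and coisometry is the normalisation of \<omega>. All results on
  coisometric rows thereby apply to the target of the intertwiner.\<close>

lemma coisometric_row_scalar_row:
  assumes "((\<lambda>i. (cmod (coord \<omega> i))\<^sup>2) has_sum 1) UNIV"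
  shows "coisometric_row (scalar_row \<omega>)"
proof
  have "cmod (cinner (cnj_ell2 \<omega>) x) \<le> norm x" for x
    using norm_cinner_Cauchy_Schwarz[of "cnj_ell2 \<omega>" x] norm_cnj_ell2_eq_1[OF assms] by simp
  thus "row_contraction (scalar_row \<omega>)"
    using scalar_row_has_sum
    by (auto simp: row_contraction_def row_scalar_row bounded_clinear_scalar_row summable_on_def)
  show "coisometric (scalar_row \<omega>)"
    unfolding coisometric_def
  proof
    fix z
    have "((\<lambda>i. complex_of_real ((cmod (coord \<omega> i))\<^sup>2) * z) has_sum complex_of_real 1 * z) UNIV"
      by (intro has_sum_cmult_left has_sum_bounded_linear[OF bounded_linear_of_real assms])
    thus "((\<lambda>i. scalar_row \<omega> i (adj (scalar_row \<omega> i) z)) has_sum z) UNIV"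
      by (simp only: scalar_row_def adj_scalar_row complex_norm_square mult.assoc of_real_1 mult_1)
  qed
qed

lemma scalar_defect_space_eq: "scalar_defect_space \<omega> = {x. row (scalar_row \<omega>) x = 0}"
  by (simp add: scalar_defect_space_def corth_compl_def row_scalar_row)

lemma basis_has_sum: "((\<lambda>i. coord x i *\<^sub>C basis i) has_sum (x :: ('i, complex) ell2)) UNIV"
  using single_has_sum[of x]
  by (simp add: scaleC_complex_def flip: single_scaleC)


section \<open>The isometric intertwiner of an ergodic row\<close>

locale ergodic_row = coisometric_row A
  for A :: "'d \<Rightarrow> 'h :: chilbert_space \<Rightarrow> 'h" +
  fixes \<Omega> :: 'h and \<omega> :: "('d, complex) ell2"
  assumes ergodic: "ergodic A" and norm_\<Omega>: "norm \<Omega> = 1"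
    and norm_\<omega>: "((\<lambda>i. (cmod (coord \<omega> i))\<^sup>2) has_sum 1) UNIV"
    and adj_\<Omega>: "adj (A i) \<Omega> = cnj (coord \<omega> i) *\<^sub>C \<Omega>"
begin

sublocale scalar: coisometric_row "scalar_row \<omega>"
  by (rule coisometric_row_scalar_row[OF norm_\<omega>])

text \<open>The adjoint of \<open>word_op A \<alpha>\<close>. Taking adjoints reverses the order, so
  the first letter acts first, which is what \<open>fold\<close> provides.\<close>

abbreviation adj_word :: "'d list \<Rightarrow> 'h \<Rightarrow> 'h" where
  "adj_word \<equiv> fold (\<lambda>i. adj (A i))"

lemma cinner_adj_word: "cinner x (adj_word \<alpha> h) = cinner (word_op A \<alpha> x) h"
  by (induction \<alpha> arbitrary: h) (simp_all add: cinner_A_adj_right)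

lemma adj_word_add: "adj_word \<alpha> (g + h) = adj_word \<alpha> g + adj_word \<alpha> h"
  by (rule cinner_eqI) (simp add: cinner_adj_word cinner_add_right)

lemma adj_word_scaleC: "adj_word \<alpha> (c *\<^sub>C h) = c *\<^sub>C adj_word \<alpha> h"
  by (rule cinner_eqI) (simp add: cinner_adj_word)

lemma cinner_\<Omega>_\<Omega> [simp]: "cinner \<Omega> \<Omega> = 1"
  by (simp add: cinner_self norm_\<Omega>)

lemma cinner_A_\<Omega>: "cinner \<Omega> (A i h) = coord \<omega> i * cinner \<Omega> h"
  using cinner_A_adj_left[of i \<Omega> h] by (simp add: adj_\<Omega>)

section \<open>Coefficients against \<Omega> and the map \<open>hat_D\<close>\<close>

lemma cinner_ell: "cinner (ell A \<Omega> \<omega> i) h = cinner \<Omega> (adj (A i) h) - cnj (coord \<omega> i) * cinner \<Omega> h"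
  by (simp add: ell_def cinner_diff_left cinner_A_adj_right)

lemma cinner_\<Omega>_adj_summable: "(\<lambda>i. (cmod (cinner \<Omega> (adj (A i) h)))\<^sup>2) summable_on UNIV"
proof (rule summable_on_comparison_test)
  show "(\<lambda>i. (norm (adj (A i) h))\<^sup>2) summable_on UNIV"
    using norm_adj_sq_has_sum summable_on_def by blast
  show "(cmod (cinner \<Omega> (adj (A i) h)))\<^sup>2 \<le> (norm (adj (A i) h))\<^sup>2" for i
    using norm_cinner_Cauchy_Schwarz[of \<Omega> "adj (A i) h"] by (simp add: norm_\<Omega> power_mono)
qed simp

definition coeffs :: "'h \<Rightarrow> ('d, complex) ell2" where
  "coeffs h = Abs_ell2 (\<lambda>i. cinner \<Omega> (adj (A i) h))"

lemma coord_coeffs [simp]: "coord (coeffs h) i = cinner \<Omega> (adj (A i) h)"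
  by (simp add: coeffs_def coord_Abs_ell2 cinner_\<Omega>_adj_summable)

text \<open>The vector \<open>hat_D A \<Omega> \<omega> h\<close>, by \<open>hat_D_eq\<close>,
  presented as the component of \<open>coeffs h\<close> orthogonal to
  \<open>cnj_ell2 \<omega>\<close>. It is used for all \<open>h\<close>, not only for those
  orthogonal to \<Omega>.\<close>

definition dl :: "'h \<Rightarrow> ('d, complex) ell2" where
  "dl h = coeffs h - cinner \<Omega> h *\<^sub>C cnj_ell2 \<omega>"

lemma coord_dl: "coord (dl h) i = cinner (ell A \<Omega> \<omega> i) h"
  by (simp add: dl_def cinner_ell scaleC_complex_def)

lemma hat_D_eq: "hat_D A \<Omega> \<omega> h = dl h"
  using basis_has_sum[of "dl h"] unfolding hat_D_def by (simp add: coord_dl infsumI)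

lemma dl_add: "dl (g + h) = dl g + dl h"
  by (rule ell2_eqI) (simp add: coord_dl cinner_add_right)

lemma dl_scaleC: "dl (c *\<^sub>C h) = c *\<^sub>C dl h"
  by (rule ell2_eqI) (simp add: coord_dl scaleC_complex_def)

lemma cinner_cnj_\<omega> [simp]: "cinner (cnj_ell2 \<omega>) (cnj_ell2 \<omega>) = 1"
  by (simp add: cinner_self norm_cnj_ell2_eq_1[OF norm_\<omega>])

lemma cinner_cnj_\<omega>_coeffs: "cinner (cnj_ell2 \<omega>) (coeffs h) = cinner \<Omega> h"
proof -
  have "((\<lambda>i. cinner (coord (cnj_ell2 \<omega>) i) (coord (coeffs h) i)) has_sum cinner \<Omega> h) UNIV"
    using cinner_adj_has_sum[of \<Omega> h] by (simp add: adj_\<Omega> cinner_complex_def)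
  thus ?thesis using ell2_cinner_has_sum has_sum_unique by blast
qed

lemma row_dl: "row (scalar_row \<omega>) (dl h) = 0"
  by (simp add: row_scalar_row dl_def cinner_diff_right cinner_cnj_\<omega>_coeffs)

text \<open>Pythagoras for the splitting of \<open>coeffs\<close> along
  \<open>cnj_ell2 \<omega>\<close>; this identity drives the telescoping over words.\<close>

lemma cinner_coeffs:
  "cinner (coeffs g) (coeffs h) = cinner (dl g) (dl h) + cnj (cinner \<Omega> g) * cinner \<Omega> h"
proof -
  have dec: "coeffs h = dl h + cinner \<Omega> h *\<^sub>C cnj_ell2 \<omega>" for h by (simp add: dl_def)
  have "cinner (cnj_ell2 \<omega>) (dl h) = 0" "cinner (dl h) (cnj_ell2 \<omega>) = 0" for h
    using row_dl[of h] cinner_commute[of "dl h" "cnj_ell2 \<omega>"] by (simp_all add: row_scalar_row)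
  thus ?thesis unfolding dec by (simp add: cinner_add_left cinner_add_right)
qed

lemma norm_coeffs_sq: "(norm (coeffs h))\<^sup>2 = (norm (dl h))\<^sup>2 + (cmod (cinner \<Omega> h))\<^sup>2"
proof -
  have "complex_of_real ((norm (coeffs h))\<^sup>2) =
      complex_of_real ((norm (dl h))\<^sup>2 + (cmod (cinner \<Omega> h))\<^sup>2)"
    unfolding of_real_add complex_norm_square[of "cinner \<Omega> h"]
    using cinner_coeffs[of h h] by (simp only: cinner_self mult.commute)
  thus ?thesis by (simp only: of_real_eq_iff)
qed

text \<open>Splitting off the first letter applies the induction hypothesis to
  \<open>adj (A i) h\<close>. The sum over \<open>i\<close> telescopes because the squared norms of
  the \<open>adj (A i) h\<close> add up to that of \<open>h\<close>, while
  \<open>norm_coeffs_sq\<close> absorbs the empty word. The finite alphabet \<open>I\<close> keeps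
  the sums finite.\<close>

lemma sum_dl_adj_word_le:
  assumes "finite I"
  shows "(cmod (cinner \<Omega> h))\<^sup>2 + (\<Sum>\<alpha>\<in>{\<alpha>. set \<alpha> \<subseteq> I \<and> length \<alpha> < n}. (norm (dl (adj_word \<alpha> h)))\<^sup>2)
    \<le> (norm h)\<^sup>2"
proof (induction n arbitrary: h)
  case 0
  have "cmod (cinner \<Omega> h) \<le> norm h"
    using norm_cinner_Cauchy_Schwarz[of \<Omega> h] by (simp add: norm_\<Omega>)
  thus ?case by (simp add: power_mono)
next
  case (Suc n)
  define L where "L n = {\<alpha>. set \<alpha> \<subseteq> I \<and> length \<alpha> < n}" for n
  have fin: "finite (L n)" for n
    by (rule finite_subset[OF _ finite_lists_length_le[OF assms, of n]]) (auto simp: L_def)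
  have L_Suc: "L (Suc n) = insert [] ((\<lambda>(i, \<alpha>). i # \<alpha>) ` (I \<times> L n))"
  proof
    show "L (Suc n) \<subseteq> insert [] ((\<lambda>(i, \<alpha>). i # \<alpha>) ` (I \<times> L n))"
    proof
      fix \<alpha> assume "\<alpha> \<in> L (Suc n)"
      thus "\<alpha> \<in> insert [] ((\<lambda>(i, \<alpha>). i # \<alpha>) ` (I \<times> L n))"
        by (cases \<alpha>) (auto simp: L_def image_iff)
    qed
  qed (auto simp: L_def)
  have "(\<Sum>\<alpha>\<in>L (Suc n). (norm (dl (adj_word \<alpha> h)))\<^sup>2) =
      (norm (dl h))\<^sup>2 + (\<Sum>\<alpha>\<in>(\<lambda>(i, \<alpha>). i # \<alpha>) ` (I \<times> L n). (norm (dl (adj_word \<alpha> h)))\<^sup>2)"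
    unfolding L_Suc using assms fin by (subst sum.insert) auto
  also have "(\<Sum>\<alpha>\<in>(\<lambda>(i, \<alpha>). i # \<alpha>) ` (I \<times> L n). (norm (dl (adj_word \<alpha> h)))\<^sup>2) =
      (\<Sum>i\<in>I. \<Sum>\<alpha>\<in>L n. (norm (dl (adj_word \<alpha> (adj (A i) h))))\<^sup>2)"
    by (subst sum.reindex) (auto simp: inj_on_def sum.cartesian_product case_prod_unfold)
  also have "\<dots> \<le> (\<Sum>i\<in>I. (norm (adj (A i) h))\<^sup>2 - (cmod (cinner \<Omega> (adj (A i) h)))\<^sup>2)"
  proof (rule sum_mono)
    show "(\<Sum>\<alpha>\<in>L n. (norm (dl (adj_word \<alpha> (adj (A i) h))))\<^sup>2)
        \<le> (norm (adj (A i) h))\<^sup>2 - (cmod (cinner \<Omega> (adj (A i) h)))\<^sup>2" for i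
      using Suc.IH[of "adj (A i) h"] by (simp add: L_def)
  qed
  also have "\<dots> \<le> (norm h)\<^sup>2 - (norm (coeffs h))\<^sup>2"
  proof (rule finite_sum_le_has_sum)
    show "((\<lambda>i. (norm (adj (A i) h))\<^sup>2 - (cmod (cinner \<Omega> (adj (A i) h)))\<^sup>2) has_sum
        (norm h)\<^sup>2 - (norm (coeffs h))\<^sup>2) UNIV"
      using has_sum_add[OF norm_adj_sq_has_sum[of h]
          has_sum_bounded_linear[OF bounded_linear_minus[OF bounded_linear_ident]
            ell2_norm_sq_has_sum[of "coeffs h"]]] by simp
    show "0 \<le> (norm (adj (A i) h))\<^sup>2 - (cmod (cinner \<Omega> (adj (A i) h)))\<^sup>2" for i
      using norm_cinner_Cauchy_Schwarz[of \<Omega> "adj (A i) h"] by (simp add: norm_\<Omega> power_mono)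
  qed (use assms in auto)
  finally show ?case by (simp add: L_def norm_coeffs_sq)
qed

text \<open>A finite set of words uses finitely many letters and has bounded length, so
  \<open>sum_dl_adj_word_le\<close> covers it.\<close>

lemma finite_sum_dl_adj_word_le:
  assumes "finite F"
  shows "(\<Sum>\<alpha>\<in>F. (norm (dl (adj_word \<alpha> h)))\<^sup>2) \<le> (norm h)\<^sup>2 - (cmod (cinner \<Omega> h))\<^sup>2"
proof -
  define I where "I = (\<Union>\<alpha>\<in>F. set \<alpha>)"
  define n where "n = Suc (\<Sum>\<alpha>\<in>F. length \<alpha>)"
  let ?L = "{\<alpha>. set \<alpha> \<subseteq> I \<and> length \<alpha> < n}"
  have "finite I" using assms by (simp add: I_def)
  hence "finite ?L"
    by (intro finite_subset[OF _ finite_lists_length_le[of I n]]) auto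
  moreover have "F \<subseteq> ?L"
    using member_le_sum[of _ F length] assms by (fastforce simp: I_def n_def less_Suc_eq_le)
  ultimately have "(\<Sum>\<alpha>\<in>F. (norm (dl (adj_word \<alpha> h)))\<^sup>2) \<le> (\<Sum>\<alpha>\<in>?L. (norm (dl (adj_word \<alpha> h)))\<^sup>2)"
    by (intro sum_mono2) auto
  thus ?thesis using sum_dl_adj_word_le[OF \<open>finite I\<close>, of h n] by linarith
qed

definition dl_words :: "'h \<Rightarrow> ('d list, ('d, complex) ell2) ell2" where
  "dl_words h = Abs_ell2 (\<lambda>\<alpha>. dl (adj_word \<alpha> h))"

lemma coord_dl_words [simp]: "coord (dl_words h) \<alpha> = dl (adj_word \<alpha> h)"
proof -
  have "(\<lambda>\<alpha>. (norm (dl (adj_word \<alpha> h)))\<^sup>2) summable_on UNIV"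
  proof (rule nonneg_bounded_partial_sums_imp_summable_on)
    show "\<forall>\<^sub>F F in finite_subsets_at_top UNIV.
        (\<Sum>\<alpha>\<in>F. (norm (dl (adj_word \<alpha> h)))\<^sup>2) \<le> (norm h)\<^sup>2 - (cmod (cinner \<Omega> h))\<^sup>2"
      by (rule eventually_finite_subsets_at_top_weakI) (rule finite_sum_dl_adj_word_le)
  qed simp
  thus ?thesis by (simp add: dl_words_def coord_Abs_ell2)
qed

section \<open>The map \<open>T\<close> and its isometry from ergodicity\<close>

definition T :: "'h \<Rightarrow> complex \<times> ('d list, ('d, complex) ell2) ell2" where
  "T h = (cinner \<Omega> h, dl_words h)"

lemma bounded_clinear_T: "bounded_clinear T"
proof (rule bounded_clinear_intro[where K = 1])
  show "T (g + h) = T g + T h" for g h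
    by (auto simp: T_def cinner_add_right adj_word_add dl_add intro!: ell2_eqI)
  show "T (c *\<^sub>C h) = c *\<^sub>C T h" for c h
    by (auto simp: T_def scaleC_prod_def scaleC_complex_def adj_word_scaleC dl_scaleC intro!: ell2_eqI)
  have "(norm (dl_words h))\<^sup>2 \<le> (norm h)\<^sup>2 - (cmod (cinner \<Omega> h))\<^sup>2" for h
    by (rule has_sum_le_finite_sums[OF ell2_norm_sq_has_sum])
      (simp_all add: finite_sum_dl_adj_word_le)
  hence "(norm (T h))\<^sup>2 \<le> (norm h)\<^sup>2" for h
    by (simp add: T_def norm_prod_def algebra_simps)
  thus "norm (T h) \<le> 1 * norm h" for h
    by (metis mult_1 norm_ge_zero power2_le_imp_le)
qed

text \<open>The telescoping as an identity: the nonempty words \<open>i # \<alpha>\<close> for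
  \<open>g\<close> and \<open>h\<close> are the words \<open>\<alpha>\<close> for
  \<open>adj (A i) g\<close> and \<open>adj (A i) h\<close>, and \<open>cinner_coeffs\<close> trades
  the empty word against the scalar components.\<close>

lemma cinner_T_adj_has_sum:
  "((\<lambda>i. cinner (T (adj (A i) g)) (T (adj (A i) h))) has_sum cinner (T g) (T h)) UNIV"
proof -
  define p where "p \<alpha> = cinner (coord (dl_words g) \<alpha>) (coord (dl_words h) \<alpha>)" for \<alpha>
  have "(p has_sum cinner (dl_words g) (dl_words h) - p []) (UNIV - {[]})"
    unfolding p_def
    by (rule has_sum_Diff[OF ell2_cinner_has_sum]) (auto intro: has_sum_finiteI)
  moreover have "bij_betw (\<lambda>(i, \<alpha>). i # \<alpha>) (UNIV \<times> UNIV) (UNIV - {[] :: 'd list})"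
    by (rule bij_betw_byWitness[where f' = "\<lambda>\<alpha>. (hd \<alpha>, tl \<alpha>)"]) auto
  ultimately have "((\<lambda>x. p (case x of (i, \<alpha>) \<Rightarrow> i # \<alpha>)) has_sum
      cinner (dl_words g) (dl_words h) - p []) (UNIV \<times> UNIV)"
    by (subst has_sum_reindex_bij_betw)
  hence words: "((\<lambda>i. cinner (dl_words (adj (A i) g)) (dl_words (adj (A i) h))) has_sum
      cinner (dl_words g) (dl_words h) - p []) UNIV"
  proof (rule has_sum_SigmaD)
    show "((\<lambda>\<alpha>. p (case (i, \<alpha>) of (i, \<alpha>) \<Rightarrow> i # \<alpha>)) has_sum
        cinner (dl_words (adj (A i) g)) (dl_words (adj (A i) h))) UNIV" for i
      using ell2_cinner_has_sum[of "dl_words (adj (A i) g)" "dl_words (adj (A i) h)"]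
      by (simp add: p_def)
  qed
  show ?thesis
    using has_sum_add[OF ell2_cinner_has_sum[of "coeffs g" "coeffs h"] words]
    by (simp add: T_def cinner_prod_def cinner_coeffs p_def cinner_complex_def algebra_simps)
qed

lemma T_\<Omega>: "T \<Omega> = (1, 0)"
proof -
  \<comment> \<open>Scalar multiples are included because each adjoint multiplies \<Omega> by a
    scalar before the next letter acts.\<close>
  have "\<exists>c. adj_word \<alpha> (a *\<^sub>C \<Omega>) = c *\<^sub>C \<Omega>" for \<alpha> a
    by (induction \<alpha> arbitrary: a) (auto simp: adj_A_scaleC adj_\<Omega>)
  hence "\<exists>c. adj_word \<alpha> \<Omega> = c *\<^sub>C \<Omega>" for \<alpha>
    using scaleC_one by metis
  moreover have "dl \<Omega> = 0"
    by (rule ell2_eqI) (simp add: coord_dl cinner_ell adj_\<Omega>)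
  ultimately have "dl (adj_word \<alpha> \<Omega>) = 0" for \<alpha>
    by (metis dl_scaleC scaleC_zero_right)
  thus ?thesis by (auto simp: T_def intro!: ell2_eqI)
qed

text \<open>
  By \<open>cinner_T_adj_has_sum\<close> the operator \<open>T\<^sup>* T\<close> is a fixed point of \<open>Z\<close>, hence scalar, and
  \<open>T \<Omega> = (1, 0)\<close> shows that the scalar is \<open>1\<close>.
\<close>
lemma cinner_T: "cinner (T g) (T h) = cinner g h"
proof -
  define X where "X h = adj T (T h)" for h
  have cinner_X: "cinner g (X h) = cinner (T g) (T h)" for g h
    by (simp add: X_def cinner_adj_right[OF bounded_clinear_T])
  have bX: "bounded_clinear X"
    unfolding X_def[abs_def]
    by (rule bounded_clinear_compose[OF bounded_clinear_adj[OF bounded_clinear_T] bounded_clinear_T])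
  then obtain K where K: "\<And>h. norm (X h) \<le> norm h * K"
    using bounded_linear.bounded[OF bounded_clinear_bounded_linear[OF bX]] by auto
  have "((\<lambda>i. A i (X (adj (A i) h))) has_sum X h) UNIV" for h
  proof -
    \<comment> \<open>Square-summability makes these vectors the coordinates of some
      \<open>x\<close>. Strong convergence then comes from \<open>row_has_sum\<close>, and only the
      value of \<open>row A x\<close> has to be found, by testing against each
      \<open>g\<close>.\<close>
    have "(\<lambda>i. (norm (X (adj (A i) h)))\<^sup>2) summable_on UNIV"
    proof (rule summable_on_comparison_test)
      show "(\<lambda>i. (norm (adj (A i) h))\<^sup>2 * K\<^sup>2) summable_on UNIV"
        using norm_adj_sq_has_sum summable_on_def by (intro summable_on_cmult_left) blast
      show "(norm (X (adj (A i) h)))\<^sup>2 \<le> (norm (adj (A i) h))\<^sup>2 * K\<^sup>2" for i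
        using power_mono[OF K[of "adj (A i) h"], of 2] by (simp add: power_mult_distrib)
    qed simp
    then obtain x where x: "\<And>i. coord x i = X (adj (A i) h)"
      using coord_Abs_ell2 by metis
    have "row A x = X h"
    proof (rule cinner_eqI)
      fix g
      have "((\<lambda>i. cinner (coord (col g) i) (coord x i)) has_sum cinner g (X h)) UNIV"
        using cinner_T_adj_has_sum[of g h] by (simp add: x cinner_X)
      thus "cinner g (row A x) = cinner g (X h)"
        using ell2_cinner_has_sum[of "col g" x] has_sum_unique by (simp add: cinner_row)
    qed
    thus ?thesis using row_has_sum[of x] by (simp add: x)
  qed
  then obtain c where c: "\<And>h. X h = c *\<^sub>C h"
    using ergodic bX unfolding ergodic_def by blast
  have "c = 1"
    using cinner_X[of \<Omega> \<Omega>] by (simp add: c T_\<Omega> cinner_prod_def cinner_complex_def)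
  thus ?thesis using cinner_X[of g h] by (simp add: c)
qed

lemma cinner_creation_left:
  assumes "\<And>\<beta>. coord \<eta> \<beta> = coord \<xi>' (i # \<beta>)"
  shows "cinner (creation i \<xi>) \<xi>' = cinner \<xi> \<eta>"
proof -
  have "((\<lambda>\<beta>. cinner (coord \<xi> \<beta>) (coord \<xi>' (i # \<beta>))) has_sum cinner \<xi> \<eta>) UNIV"
    using ell2_cinner_has_sum[of \<xi> \<eta>] by (simp add: assms)
  hence "((\<lambda>\<alpha>. cinner (coord (creation i \<xi>) \<alpha>) (coord \<xi>' \<alpha>)) has_sum cinner \<xi> \<eta>) UNIV"
    by (rule creation_has_sum[where f = "\<lambda>\<alpha> x. cinner x (coord \<xi>' \<alpha>)"]) simp
  thus ?thesis using ell2_cinner_has_sum has_sum_unique by blast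
qed

text \<open>The vacuum coordinate contributes a multiple of
  \<open>cinner (ell A \<Omega> \<omega> i) h\<close>, whose correction term cancels the scalar
  component; pairing with the created part strips the letter \<open>i\<close>.\<close>

lemma cinner_dilation_T:
  "cinner (dilation (scalar_row \<omega>) i u) (T h) = cinner u (T (adj (A i) h))"
proof -
  obtain z \<xi> where u: "u = (z, \<xi>)" by (cases u)
  have "cinner (creation i \<xi>) (dl_words h) = cinner \<xi> (dl_words (adj (A i) h))"
    by (rule cinner_creation_left) simp
  thus ?thesis
    by (simp add: u dilation_def T_def cinner_prod_def cinner_add_left basis_tensor
        scalar.cinner_defect_vec_left[OF row_dl] coord_dl cinner_ell scalar_row_def
        cinner_complex_def algebra_simps)
qed

sublocale isometric_intertwiner A "dilation (scalar_row \<omega>)" T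
  by standard
    (simp_all add: scalar.bounded_clinear_dilation scalar.cinner_dilation bounded_clinear_T
      cinner_T cinner_dilation_T)

end


section \<open>Minimality of the dilation\<close>

lemma norm_single [simp]: "norm (single i x) = norm x"
proof -
  have "(norm (single i x))\<^sup>2 = (norm x)\<^sup>2" by (simp add: norm_sq_eq_cinner)
  thus ?thesis by (simp add: power2_eq_iff_nonneg)
qed

lemma bounded_clinear_single: "bounded_clinear (single i)"
  by (rule bounded_clinear_intro[where K = 1]) (simp_all add: single_add single_scaleC)

lemma creation_single: "creation i (single \<alpha> x) = single (i # \<alpha>) x"
  using creation_tensor[of i "basis \<alpha>" x] by (simp add: creation_basis basis_tensor)

lemma closed_has_sum_mem:
  assumes "closed R" "0 \<in> R" "\<forall>x\<in>R. \<forall>y\<in>R. x + y \<in> R"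
    and "(f has_sum s) I" "\<And>i. f i \<in> R"
  shows "s \<in> R"
proof (rule Lim_in_closed_set[OF assms(1)])
  have "sum f F \<in> R" for F
    using assms by (induction F rule: infinite_finite_induct) auto
  thus "\<forall>\<^sub>F F in finite_subsets_at_top I. sum f F \<in> R" by simp
  show "(sum f \<longlongrightarrow> s) (finite_subsets_at_top I)" using assms(4) by (simp add: has_sum_def)
qed simp

context coisometric_row
begin

lemma dilation_space_0: "0 \<in> dilation_space A"
  by (simp add: dilation_space_iff row.zero)

lemma dilation_space_add: "\<forall>u\<in>dilation_space A. \<forall>v\<in>dilation_space A. u + v \<in> dilation_space A"
  by (simp add: dilation_space_iff row.add)

lemma dilation_space_scaleC: "u \<in> dilation_space A \<Longrightarrow> c *\<^sub>C u \<in> dilation_space A"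
  by (simp add: dilation_space_iff scaleC_prod_def bounded_clinear_scaleC[OF bounded_clinear_row])

lemma closed_dilation_space: "closed (dilation_space A)"
proof -
  have "bounded_linear (\<lambda>u :: 'h \<times> ('d list, ('d, 'h) ell2) ell2. row A (coord (snd u) \<alpha>))" for \<alpha>
    by (intro bounded_linear_compose[OF row.bounded_linear_axioms]
        bounded_linear_compose[OF bounded_clinear_bounded_linear[OF bounded_clinear_coord]]
        bounded_linear_snd)
  hence "closed {u :: 'h \<times> ('d list, ('d, 'h) ell2) ell2. row A (coord (snd u) \<alpha>) = 0}" for \<alpha>
    by (intro closed_Collect_eq continuous_on_const linear_continuous_on)
  hence "closed (\<Inter>\<alpha>. {u :: 'h \<times> ('d list, ('d, 'h) ell2) ell2. row A (coord (snd u) \<alpha>) = 0})"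
    by (intro closed_INT) blast
  also have "(\<Inter>\<alpha>. {u. row A (coord (snd u) \<alpha>) = 0}) = dilation_space A"
    by (auto simp: dilation_space_iff)
  finally show ?thesis .
qed

lemma dilation_in_dilation_space:
  assumes "u \<in> dilation_space A"
  shows "dilation A i u \<in> dilation_space A"
proof -
  have "row A (defect_vec A i h) = 0" for h
    using defect_vec_in_defect_space defect_space_eq by blast
  thus ?thesis using assms
    by (cases u)
      (auto simp: dilation_space_iff dilation_def basis_tensor creation.rep_eq row.zero
        split: list.splits)
qed

lemma base_in_dilation_space: "(h, 0) \<in> dilation_space A"
  by (simp add: dilation_space_iff row.zero)

lemma vacuum_in_dilation_space: "x \<in> defect_space A \<Longrightarrow> (0, vacuum \<otimes> x) \<in> dilation_space A"
  by (simp add: dilation_space_iff basis_tensor defect_space_eq row.zero)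

text \<open>Adding \<open>(- A i h, 0)\<close> to the dilation of \<open>(h, 0)\<close> isolates a
  defect vector at the vacuum. Sums of these exhaust the defect space there, the dilation then
  prepends letters, and limits give the whole dilation space.\<close>

lemma dilation_minimal:
  assumes closed: "closed R" and add: "\<forall>u\<in>R. \<forall>v\<in>R. u + v \<in> R"
    and base: "\<And>h. (h, 0) \<in> R" and inv: "\<And>i u. u \<in> R \<Longrightarrow> dilation A i u \<in> R"
  shows "dilation_space A \<subseteq> R"
proof -
  have zero: "0 \<in> R" using base[of 0] by (simp add: zero_prod_def)
  note has_sum_mem = closed_has_sum_mem[OF closed zero add]
  have vec: "(0, single [] (defect_vec A i h)) \<in> R" for i h
    using bspec[OF bspec[OF add inv[OF base[of h], of i]] base[of "- A i h"]]
    by (simp add: dilation_def basis_tensor creation_single[symmetric] creation_scaleC[of _ 0, simplified])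
  have "((\<lambda>i. (0, single [] (defect_vec A i (coord x i)))) has_sum
      (0 :: 'h, single [] (defect_op A x))) UNIV" for x
    unfolding defect_vec_def
    by (rule has_sum_bounded_linear[OF _ single_has_sum])
      (intro bounded_linear_Pair bounded_linear_zero defect_op.bounded_linear_axioms
        bounded_linear_compose[OF bounded_clinear_bounded_linear[OF bounded_clinear_single]])
  hence "(0, single [] (defect_op A x)) \<in> R" for x
    by (rule has_sum_mem) (rule vec)
  \<comment> \<open>Vectors in the kernel of \<open>row A\<close> are fixed by the defect
    operator.\<close>
  hence vac: "(0, single [] x) \<in> R" if "row A x = 0" for x
    using defect_op_eq[of x] that by (simp add: col.zero) metis
  have word: "(0, single \<alpha> x) \<in> R" if "row A x = 0" for \<alpha> x
  proof (induction \<alpha>)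
    case (Cons i \<alpha>)
    have "defect_vec A i 0 = 0" by (simp add: defect_vec_eq A.zero col.zero)
    thus ?case using inv[OF Cons, of i]
      by (simp add: dilation_def A.zero basis_tensor creation_single)
  qed (use vac that in blast)
  show ?thesis
  proof
    fix u assume u: "u \<in> dilation_space A"
    obtain h \<xi> where h: "u = (h, \<xi>)" by (cases u)
    have "((\<lambda>\<alpha>. (0, single \<alpha> (coord \<xi> \<alpha>))) has_sum (0 :: 'h, \<xi>)) UNIV"
      by (rule has_sum_bounded_linear[OF _ single_has_sum])
        (intro bounded_linear_Pair bounded_linear_zero bounded_linear_ident)
    hence "(0, \<xi>) \<in> R"
      by (rule has_sum_mem) (use u in \<open>simp add: word h dilation_space_iff\<close>)
    thus "u \<in> R" using bspec[OF bspec[OF add base[of h]]] by (fastforce simp: h)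
  qed
qed

end


section \<open>The extended characteristic function\<close>

context ergodic_row
begin

lemma scalar_dilation_space:
  "UNIV \<times> fock_tensor (scalar_defect_space \<omega>) = dilation_space (scalar_row \<omega>)"
  by (simp add: dilation_space_def scalar.defect_space_eq scalar_defect_space_eq)

lemma T_in_dilation_space: "T h \<in> dilation_space (scalar_row \<omega>)"
  by (simp add: scalar.dilation_space_iff T_def row_dl)

lemma \<Phi>_in_dilation_space: "\<Phi> x \<in> dilation_space (scalar_row \<omega>)"
proof (rule closed_has_sum_mem[OF scalar.closed_dilation_space scalar.dilation_space_0
      scalar.dilation_space_add])
  show "((\<lambda>i. dilation (scalar_row \<omega>) i (T (coord x i))) has_sum \<Phi> x) UNIV"
    by (rule ST.has_sum_total) simp
qed (auto intro: scalar.dilation_in_dilation_space T_in_dilation_space)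

lemma W_in_dilation_space:
  assumes "u \<in> dilation_space A"
  shows "W u \<in> dilation_space (scalar_row \<omega>)"
proof -
  obtain h \<xi> where u: "u = (h, \<xi>)" by (cases u)
  have word: "word_op (dilation (scalar_row \<omega>)) \<alpha> (\<Phi> x) \<in> dilation_space (scalar_row \<omega>)" for \<alpha> x
    by (induction \<alpha>) (auto intro: scalar.dilation_in_dilation_space \<Phi>_in_dilation_space)
  have "((\<lambda>\<alpha>. word_op (dilation (scalar_row \<omega>)) \<alpha> (\<Phi> (coord \<xi> \<alpha>))) has_sum \<Psi>.total \<xi>) UNIV"
    using assms by (intro \<Psi>.has_sum_total) (simp add: u dilation_space_iff)
  hence "\<Psi>.total \<xi> \<in> dilation_space (scalar_row \<omega>)"
    by (rule closed_has_sum_mem[OF scalar.closed_dilation_space scalar.dilation_space_0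
          scalar.dilation_space_add]) (simp_all add: word)
  thus ?thesis
    by (simp add: u W_def scalar.dilation_space_add T_in_dilation_space)
qed

text \<open>Expanding both squared norms by \<open>norm_diff_sq\<close> involves only inner products
  of values of \<open>V\<close> on \<open>K\<close>.\<close>

lemma isometric_norm:
  assumes "\<And>u v. u \<in> K \<Longrightarrow> v \<in> K \<Longrightarrow> cinner (V u) (V v) = cinner u v" "u \<in> K" "v \<in> K"
  shows "norm (V u - V v) = norm (u - v)"
proof -
  have "(norm (V u - V v))\<^sup>2 = (norm (u - v))\<^sup>2" by (simp only: norm_diff_sq assms)
  thus ?thesis by (simp add: power2_eq_iff_nonneg)
qed

text \<open>
  The vectors \<open>W u\<close> with \<open>V u = W u\<close> form a closed subspace that contains \<open>(1, 0)\<close> and is invariant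
  under the dilation of the scalar row, so they exhaust its minimal space.  Taking \<open>V = W\<close>
  gives surjectivity, an arbitrary intertwiner \<open>V\<close> gives uniqueness.
\<close>
lemma exists_common_preimage:
  assumes V_add: "\<And>u v. u \<in> dilation_space A \<Longrightarrow> v \<in> dilation_space A \<Longrightarrow> V (u + v) = V u + V v"
    and V_scaleC: "\<And>c u. u \<in> dilation_space A \<Longrightarrow> V (c *\<^sub>C u) = c *\<^sub>C V u"
    and V_cinner: "\<And>u v. u \<in> dilation_space A \<Longrightarrow> v \<in> dilation_space A \<Longrightarrow>
      cinner (V u) (V v) = cinner u v"
    and V_dilation: "\<And>i u. u \<in> dilation_space A \<Longrightarrow> V (dilation A i u) = dilation (scalar_row \<omega>) i (V u)"
    and V_\<Omega>: "V (\<Omega>, 0) = (1, 0)"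
    and v: "v \<in> dilation_space (scalar_row \<omega>)"
  shows "\<exists>u\<in>dilation_space A. W u = v \<and> V u = v"
proof -
  define R where "R = {v. \<exists>u\<in>dilation_space A. W u = v \<and> V u = v}"
  have "dilation_space (scalar_row \<omega>) \<subseteq> R"
  proof (rule scalar.dilation_minimal)
    show "closed R"
      unfolding closed_sequential_limits
    proof (intro allI impI)
      fix X v assume X: "(\<forall>n. X n \<in> R) \<and> X \<longlonglongrightarrow> v"
      hence "\<forall>n. \<exists>u. u \<in> dilation_space A \<and> W u = X n \<and> V u = X n"
        unfolding R_def by blast
      from choice[OF this] obtain u where
        "\<forall>n. u n \<in> dilation_space A \<and> W (u n) = X n \<and> V (u n) = X n" ..
      hence u: "u n \<in> dilation_space A" "W (u n) = X n" "V (u n) = X n" for n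
        by blast+
      have "dist (u m) (u n) = dist (X m) (X n)" for m n
        \<comment> \<open>Isometry of \<open>W\<close> pulls the Cauchy property back from the
          convergent images to the preimages.\<close>
        using isometric_norm[of "dilation_space A" W "u m" "u n"] u cinner_W by (simp add: dist_norm)
      hence "Cauchy u"
        using LIMSEQ_imp_Cauchy[of X v] X by (simp add: Cauchy_def)
      then obtain l where l: "u \<longlonglongrightarrow> l" using Cauchy_convergent convergent_def by blast
      have lK: "l \<in> dilation_space A"
        using closed_sequentially[OF closed_dilation_space] u(1) l by blast
      \<comment> \<open>A generic isometry \<open>Y\<close> stands for both \<open>W\<close> and
        \<open>V\<close>, so that the limit \<open>l\<close> is a preimage of \<open>v\<close> under
        each.\<close>
      have "Y l = v" if "\<And>u v. u \<in> dilation_space A \<Longrightarrow> v \<in> dilation_space A \<Longrightarrow>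
          cinner (Y u) (Y v) = cinner u v" and "\<And>n. Y (u n) = X n"
        for Y :: "'h \<times> ('d list, ('d, 'h) ell2) ell2 \<Rightarrow> complex \<times> ('d list, ('d, complex) ell2) ell2"
      proof -
        have "dist (X n) (Y l) = dist (u n) l" for n
          using isometric_norm[of "dilation_space A" Y "u n" l] that u(1) lK by (simp add: dist_norm)
        hence "X \<longlonglongrightarrow> Y l" using l by (simp add: tendsto_iff)
        thus ?thesis using X LIMSEQ_unique by blast
      qed
      from this[of W] this[of V] show "v \<in> R"
        unfolding R_def using lK cinner_W V_cinner u by blast
    qed
    show "\<forall>u\<in>R. \<forall>w\<in>R. u + w \<in> R"
    proof (intro ballI)
      fix u w assume uw: "u \<in> R" "w \<in> R"
      obtain a b where "a \<in> dilation_space A" "W a = u" "V a = u"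
        "b \<in> dilation_space A" "W b = w" "V b = w"
        using uw by (auto simp: R_def)
      hence "a + b \<in> dilation_space A" "W (a + b) = u + w" "V (a + b) = u + w"
        by (simp_all add: dilation_space_add W_add V_add)
      thus "u + w \<in> R" unfolding R_def by blast
    qed
    show "(z, 0) \<in> R" for z
    proof -
      have "z *\<^sub>C (\<Omega>, 0) \<in> dilation_space A"
        by (simp add: dilation_space_scaleC base_in_dilation_space)
      moreover have "W (z *\<^sub>C (\<Omega>, 0)) = (z, 0)" "V (z *\<^sub>C (\<Omega>, 0)) = (z, 0)"
        by (simp_all add: W_scaleC V_scaleC base_in_dilation_space W_base V_\<Omega> T_\<Omega>)
          (simp_all add: scaleC_prod_def scaleC_complex_def)
      ultimately show ?thesis unfolding R_def by blast
    qed
    show "dilation (scalar_row \<omega>) i w \<in> R" if w: "w \<in> R" for i w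
    proof -
      obtain a where "a \<in> dilation_space A" "W a = w" "V a = w"
        using w unfolding R_def by blast
      hence "dilation A i a \<in> dilation_space A"
        "W (dilation A i a) = dilation (scalar_row \<omega>) i w" "V (dilation A i a) = dilation (scalar_row \<omega>) i w"
        by (simp_all add: dilation_in_dilation_space W_dilation V_dilation)
      thus ?thesis unfolding R_def by blast
    qed
  qed
  thus ?thesis using v by (auto simp: R_def)
qed

lemma is_intertwiner_W: "is_intertwiner A \<Omega> \<omega> W"
proof -
  have "inj_on W (dilation_space A)"
  proof (rule inj_onI)
    fix u v assume "u \<in> dilation_space A" "v \<in> dilation_space A" "W u = W v"
    thus "u = v" using isometric_norm[of "dilation_space A" W u v] cinner_W by simp
  qed
  moreover have "W ` dilation_space A = dilation_space (scalar_row \<omega>)"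
  proof
    show "W ` dilation_space A \<subseteq> dilation_space (scalar_row \<omega>)"
      using W_in_dilation_space by blast
    show "dilation_space (scalar_row \<omega>) \<subseteq> W ` dilation_space A"
    proof
      fix v assume "v \<in> dilation_space (scalar_row \<omega>)"
      hence "\<exists>u\<in>dilation_space A. W u = v \<and> W u = v"
        by (rule exists_common_preimage[rotated 5])
          (auto simp: W_add W_scaleC cinner_W W_dilation W_base T_\<Omega>)
      thus "v \<in> W ` dilation_space A" by blast
    qed
  qed
  ultimately show ?thesis
    by (simp add: is_intertwiner_def unitary_between_def scalar_dilation_space bij_betw_def
        W_add W_scaleC cinner_W W_dilation W_base T_\<Omega>)
qed

text \<open>The common preimage \<open>w\<close> of \<open>V u\<close> under \<open>W\<close> and
  \<open>V\<close> must be \<open>u\<close> by injectivity of \<open>V\<close>.\<close>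

lemma intertwiner_unique:
  assumes V: "is_intertwiner A \<Omega> \<omega> V" and u: "u \<in> dilation_space A"
  shows "V u = W u"
proof -
  have V': "unitary_between (dilation_space A) (dilation_space (scalar_row \<omega>)) V"
    "\<And>i u. u \<in> dilation_space A \<Longrightarrow> V (dilation A i u) = dilation (scalar_row \<omega>) i (V u)"
    "V (\<Omega>, 0) = (1, 0)"
    using V by (auto simp: is_intertwiner_def scalar_dilation_space)
  hence "V u \<in> dilation_space (scalar_row \<omega>)"
    using u by (auto simp: unitary_between_def bij_betw_def)
  hence "\<exists>w\<in>dilation_space A. W w = V u \<and> V w = V u"
    by (rule exists_common_preimage[rotated 5]) (use V' in \<open>auto simp: unitary_between_def\<close>)
  then obtain w where w: "w \<in> dilation_space A" "W w = V u" "V w = V u" by blast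
  have "inj_on V (dilation_space A)"
    using V' by (simp add: unitary_between_def bij_betw_def)
  hence "w = u" using w u by (auto dest: inj_onD)
  thus ?thesis using w by simp
qed

text \<open>The choice operator selects an intertwiner by \<open>is_intertwiner_W\<close>, and
  \<open>intertwiner_unique\<close> fixes its values on the dilation space, to which
  \<open>(0, vacuum \<otimes> x)\<close> belongs.\<close>

lemma ext_char_fun_eq:
  assumes "x \<in> defect_space A"
  shows "ext_char_fun A \<Omega> \<omega> x = \<Phi> x"
proof -
  have "is_intertwiner A \<Omega> \<omega> (SOME W. is_intertwiner A \<Omega> \<omega> W)"
    by (rule someI[of "is_intertwiner A \<Omega> \<omega>", OF is_intertwiner_W])
  thus ?thesis
    unfolding ext_char_fun_def
    using intertwiner_unique[OF _ vacuum_in_dilation_space[OF assms]] W_vacuum assms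
    by (simp add: defect_space_eq)
qed

section \<open>Components of \<open>\<Phi> x\<close>\<close>

lemma fst_\<Phi>:
  assumes "row A x = 0"
  shows "fst (\<Phi> x) = 0"
  using cinner_\<Phi>_T[of x \<Omega>] assms by (simp add: T_\<Omega> cinner_prod_def cinner_complex_def)

text \<open>The test vector is the dilation of \<open>(1, 0)\<close>. Its scalar component meets
  \<open>fst (\<Phi> x) = 0\<close>, and its defect vector reads off the \<open>i\<close>-th
  coordinate because the vacuum coordinate of \<open>\<Phi> x\<close> lies in the kernel of the
  scalar row.\<close>

lemma coord_\<Phi>_Nil:
  assumes "row A x = 0"
  shows "coord (coord (snd (\<Phi> x)) []) i = cinner \<Omega> (coord x i)"
proof -
  have r: "row (scalar_row \<omega>) (coord (snd (\<Phi> x)) []) = 0"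
    using \<Phi>_in_dilation_space scalar.dilation_space_iff by blast
  have "cinner (coord (snd (\<Phi> x)) []) (defect_vec (scalar_row \<omega>) i 1) =
      cnj (coord (coord (snd (\<Phi> x)) []) i)"
    using scalar.cinner_defect_vec_left[OF r, of i 1]
      cinner_commute[of "coord (snd (\<Phi> x)) []" "defect_vec (scalar_row \<omega>) i 1"]
    by (simp add: cinner_complex_def)
  moreover have "creation i 0 = (0 :: ('d list, ('d, complex) ell2) ell2)"
    using creation_scaleC[of i 0 0] by simp
  ultimately show ?thesis
    using cinner_\<Phi>_S[of x i "(1, 0)"] fst_\<Phi>[OF assms]
    by (simp add: dilation_def cinner_prod_def T_def basis_tensor cinner_complex_def)
qed

text \<open>The dilation of \<open>(0, single \<alpha> y)\<close> by \<open>j\<close> is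
  \<open>(0, single (j # \<alpha>) y)\<close>, which isolates this coordinate.\<close>

lemma coord_\<Phi>_Cons: "coord (snd (\<Phi> x)) (j # \<alpha>) = dl (adj_word \<alpha> (coord x j))"
proof (rule cinner_eqI)
  fix y
  have "defect_vec (scalar_row \<omega>) j 0 = 0"
    by (simp add: scalar.defect_vec_eq scalar.A.zero scalar.col.zero)
  hence "cinner (coord (snd (\<Phi> x)) (j # \<alpha>)) y = cinner (dl (adj_word \<alpha> (coord x j))) y"
    using cinner_\<Phi>_S[of x j "(0, single \<alpha> y)"]
    by (simp add: dilation_def cinner_prod_def T_def basis_tensor creation_single scalar.A.zero)
  thus "cinner y (coord (snd (\<Phi> x)) (j # \<alpha>)) = cinner y (dl (adj_word \<alpha> (coord x j)))"
    by (metis cinner_commute)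
qed

lemma dl_adj_word_\<Omega>: "dl (adj_word \<alpha> \<Omega>) = 0"
  using T_\<Omega> coord_dl_words[of \<Omega> \<alpha>] by (simp add: T_def del: coord_dl_words)

lemma dl_adj_word_diff: "dl (adj_word \<alpha> (g - h)) = dl (adj_word \<alpha> g) - dl (adj_word \<alpha> h)"
  using dl_add[of "adj_word \<alpha> (g - h)" "adj_word \<alpha> h"] by (simp flip: adj_word_add)

lemma dl_adj_word_scaleC_\<Omega>: "dl (adj_word \<alpha> (c *\<^sub>C \<Omega>)) = 0"
  by (simp add: adj_word_scaleC dl_scaleC dl_adj_word_\<Omega>)

section \<open>The orthogonal complement of \<Omega> and adjoints taken in it\<close>

abbreviation H0 :: "'h set" where
  "H0 \<equiv> corth_compl {\<Omega>}"

lemma H0_iff: "h \<in> H0 \<longleftrightarrow> cinner \<Omega> h = 0"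
  by (simp add: corth_compl_def)

lemma ell_in_H0: "ell A \<Omega> \<omega> i \<in> H0"
  by (simp add: H0_iff ell_def cinner_diff_right cinner_A_\<Omega>)

text \<open>Invariance is proved along with the equality because \<open>ring_op\<close> is a
  restriction, with an unspecified value outside \<open>H0\<close>.\<close>

lemma word_op_ring_op:
  assumes "h \<in> H0"
  shows "word_op (ring_op A \<Omega>) \<alpha> h = word_op A \<alpha> h \<and> word_op A \<alpha> h \<in> H0"
  using assms by (induction \<alpha>) (auto simp: ring_op_def H0_iff cinner_A_\<Omega>)

text \<open>The adjoint of a restriction is the adjoint on the whole space followed by the
  projection onto \<open>H0\<close>; the removed multiple of \<Omega> is invisible to vectors of
  \<open>H0\<close>.\<close>

lemma adj_on_H0:
  assumes "\<And>x. x \<in> H0 \<Longrightarrow> B x = C x" "\<And>x. cinner x z = cinner (C x) y"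
  shows "adj_on H0 B y = z - cinner \<Omega> z *\<^sub>C \<Omega>"
proof (rule adj_on_eqI)
  fix x assume x: "x \<in> H0"
  hence "cinner x \<Omega> = 0" using cinner_commute[of x \<Omega>] by (simp add: H0_iff)
  thus "cinner x (z - cinner \<Omega> z *\<^sub>C \<Omega>) = cinner (B x) y"
    by (simp add: cinner_diff_right assms x)
qed (auto simp: H0_iff cinner_diff_right)

text \<open>The projections onto \<open>H0\<close> change vectors by multiples of \<Omega>, which
  \<open>dl\<close> after any adjoint word kills. What remains is the \<open>j\<close>-th coordinate
  of the defect vector.\<close>

lemma hat_D_adj_on:
  assumes "h \<in> H0"
  shows "hat_D A \<Omega> \<omega> (adj_on H0 (word_op (ring_op A \<Omega>) \<alpha>)
      ((if j = i then h else 0) - adj_on H0 (ring_op A \<Omega> j) (ring_op A \<Omega> i h))) =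
    dl (adj_word \<alpha> (coord (defect_vec A i h) j))"
proof -
  have 1: "adj_on H0 (word_op (ring_op A \<Omega>) \<alpha>) y = adj_word \<alpha> y - cinner \<Omega> (adj_word \<alpha> y) *\<^sub>C \<Omega>" for y
    by (rule adj_on_H0[where C = "word_op A \<alpha>"]) (simp_all add: word_op_ring_op cinner_adj_word)
  have 2: "adj_on H0 (ring_op A \<Omega> j) y = adj (A j) y - cinner \<Omega> (adj (A j) y) *\<^sub>C \<Omega>" for y
    by (rule adj_on_H0[where C = "A j"]) (simp_all add: ring_op_def cinner_A_adj_right)
  have "dl (g - c *\<^sub>C \<Omega>) = dl g" for g c
    using dl_adj_word_diff[of "[]" g "c *\<^sub>C \<Omega>"] dl_adj_word_scaleC_\<Omega>[of "[]"] by simp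
  moreover have "ring_op A \<Omega> i h = A i h" using assms by (simp add: ring_op_def)
  ultimately show ?thesis
    by (simp add: hat_D_eq 1 2 dl_adj_word_diff dl_adj_word_scaleC_\<Omega> coord_defect_vec)
qed

sublocale creation: orthogonal_isometries
  "creation :: 'd \<Rightarrow> ('d list, ('d, complex) ell2) ell2 \<Rightarrow> ('d list, ('d, complex) ell2) ell2" UNIV
  by standard (rule cinner_creation)

lemma dl_words_summable: "(\<lambda>j. (norm (dl_words (coord x j)))\<^sup>2) summable_on UNIV"
proof (rule summable_on_comparison_test[OF coord_summable])
  show "(norm (dl_words (coord x j)))\<^sup>2 \<le> (norm (coord x j))\<^sup>2" for j
  proof (rule has_sum_le_finite_sums[OF ell2_norm_sq_has_sum])
    fix F :: "'d list set" assume "finite F"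
    from finite_sum_dl_adj_word_le[OF this, of "coord x j"]
    show "(\<Sum>\<alpha>\<in>F. (norm (coord (dl_words (coord x j)) \<alpha>))\<^sup>2) \<le> (norm (coord x j))\<^sup>2"
      using zero_le_power2[of "cmod (cinner \<Omega> (coord x j))"]
      by (simp only: coord_dl_words)
  qed
qed simp

text \<open>The nonempty words are grouped by first letter. The outer sum exists because the
  creation operators are isometries with orthogonal ranges.\<close>

lemma creation_dl_words_has_sum:
  "((\<lambda>j. creation j (dl_words (coord x j))) has_sum
    snd (\<Phi> x) - vacuum \<otimes> coord (snd (\<Phi> x)) []) UNIV"
proof -
  let ?x = "Abs_ell2 (\<lambda>j. dl_words (coord x j))"
  have x: "coord ?x j = dl_words (coord x j)" for j
    by (simp add: coord_Abs_ell2 dl_words_summable)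
  have hs: "((\<lambda>j. creation j (dl_words (coord x j))) has_sum creation.total ?x) UNIV"
    using creation.has_sum_total[of ?x] by (simp add: x)
  have "coord (creation.total ?x) \<alpha> = coord (snd (\<Phi> x) - vacuum \<otimes> coord (snd (\<Phi> x)) []) \<alpha>" for \<alpha>
  proof (cases \<alpha>)
    case Nil
    have "((\<lambda>j. coord (creation j (dl_words (coord x j))) []) has_sum coord (creation.total ?x) []) UNIV"
      by (rule has_sum_bounded_linear[OF bounded_clinear_bounded_linear[OF bounded_clinear_coord] hs])
    from infsumI[OF this] show ?thesis by (simp add: Nil)
  next
    case (Cons j \<beta>)
    have "cinner y (coord (creation.total ?x) (j # \<beta>)) = cinner y (dl (adj_word \<beta> (coord x j)))" for y
      using creation.cinner_U_total[of "single \<beta> y" ?x j] by (simp add: creation_single x)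
    hence "coord (creation.total ?x) (j # \<beta>) = dl (adj_word \<beta> (coord x j))" by (rule cinner_eqI)
    thus ?thesis by (simp add: Cons coord_\<Phi>_Cons)
  qed
  hence "creation.total ?x = snd (\<Phi> x) - vacuum \<otimes> coord (snd (\<Phi> x)) []" by (rule ell2_eqI)
  thus ?thesis using hs by simp
qed

lemma row_defect_vec: "row A (defect_vec A i h) = 0"
  using defect_vec_in_defect_space defect_space_eq by blast

section \<open>Range and series expansions of the extended characteristic function\<close>

lemma ext_char_fun_in_fock_tensor:
  assumes "x \<in> defect_space A"
  shows "ext_char_fun A \<Omega> \<omega> x \<in> {0} \<times> fock_tensor (scalar_defect_space \<omega>)"
proof -
  have "\<Phi> x \<in> UNIV \<times> fock_tensor (scalar_defect_space \<omega>)"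
    using \<Phi>_in_dilation_space scalar_dilation_space by blast
  thus ?thesis
    using fst_\<Phi>[of x] assms by (cases "\<Phi> x") (simp add: ext_char_fun_eq[OF assms] defect_space_eq)
qed

lemma cinner_ell_has_sum: "((\<lambda>j. cinner (ell A \<Omega> \<omega> j) h *\<^sub>C basis j) has_sum dl h) UNIV"
  using basis_has_sum[of "dl h"] by (simp add: coord_dl)

lemma cinner_A_\<Omega>_has_sum: "((\<lambda>j. cinner (A j \<Omega>) h *\<^sub>C basis j) has_sum coeffs h) UNIV"
  using basis_has_sum[of "coeffs h"] by (simp add: cinner_A_adj_right)

lemma cinner_ring_word_has_sum:
  "((\<lambda>j. cinner (word_op (ring_op A \<Omega>) \<alpha> (ell A \<Omega> \<omega> j)) h *\<^sub>C basis j) has_sum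
    dl (adj_word \<alpha> h)) UNIV"
  using cinner_ell_has_sum[of "adj_word \<alpha> h"] word_op_ring_op[OF ell_in_H0]
  by (simp add: cinner_adj_word)

lemma dl_words_nonempty_has_sum:
  "((\<lambda>\<alpha>. basis \<alpha> \<otimes> dl (adj_word \<alpha> h)) has_sum dl_words h - vacuum \<otimes> dl h) {\<alpha>. length \<alpha> \<ge> 1}"
proof -
  have "((\<lambda>\<alpha>. single \<alpha> (dl (adj_word \<alpha> h))) has_sum dl_words h - single [] (dl h)) (UNIV - {[]})"
    using single_has_sum[of "dl_words h"]
    by (intro has_sum_Diff) (auto intro: has_sum_finiteI)
  also have "UNIV - {[]} = {\<alpha> :: 'd list. length \<alpha> \<ge> 1}"
    by (auto simp: Suc_le_eq)
  finally show ?thesis by (simp add: basis_tensor)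
qed

lemma dl_words_has_sum: "((\<lambda>\<alpha>. basis \<alpha> \<otimes> dl (adj_word \<alpha> h)) has_sum dl_words h) UNIV"
  using tensor_expansion[of "dl_words h"] by simp

text \<open>At a word \<open>j # \<beta>\<close>, the \<open>j\<close>-th coordinate of the defect
  vector equals \<open>- adj (A j) (ell A \<Omega> \<omega> i)\<close> up to a multiple of \<Omega>,
  which \<open>dl\<close> after an adjoint word kills. Removing the vacuum term of
  \<open>dl_words\<close> leaves the nonempty words.\<close>

lemma ext_char_fun_\<Omega>:
  "ext_char_fun A \<Omega> \<omega> (defect_vec A i \<Omega>) =
    (0, vacuum \<otimes> (basis i - coeffs (A i \<Omega>)) -
      (dl_words (ell A \<Omega> \<omega> i) - vacuum \<otimes> dl (ell A \<Omega> \<omega> i)))"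
proof -
  let ?x = "defect_vec A i \<Omega>"
  have "coord (snd (\<Phi> ?x)) \<alpha> = coord (vacuum \<otimes> (basis i - coeffs (A i \<Omega>)) -
      (dl_words (ell A \<Omega> \<omega> i) - vacuum \<otimes> dl (ell A \<Omega> \<omega> i))) \<alpha>" for \<alpha>
  proof (cases \<alpha>)
    case Nil
    have "coord (snd (\<Phi> ?x)) [] = basis i - coeffs (A i \<Omega>)"
      by (rule ell2_eqI)
        (simp add: coord_\<Phi>_Nil row_defect_vec coord_defect_vec cinner_diff_right)
    thus ?thesis by (simp add: Nil)
  next
    case (Cons j \<beta>)
    have "adj (A j) (ell A \<Omega> \<omega> i) = adj (A j) (A i \<Omega>) - (coord \<omega> i * cnj (coord \<omega> j)) *\<^sub>C \<Omega>"
      by (simp add: ell_def adj.diff adj_A_scaleC adj_\<Omega>)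
    thus ?thesis
      by (simp add: Cons coord_\<Phi>_Cons coord_defect_vec dl_adj_word_diff dl_adj_word_scaleC_\<Omega>
          dl_adj_word_\<Omega> dl_adj_word_scaleC_\<Omega>[of _ 0, simplified])
  qed
  hence "snd (\<Phi> ?x) = vacuum \<otimes> (basis i - coeffs (A i \<Omega>)) -
      (dl_words (ell A \<Omega> \<omega> i) - vacuum \<otimes> dl (ell A \<Omega> \<omega> i))"
    by (rule ell2_eqI)
  thus ?thesis
    using fst_\<Phi>[OF row_defect_vec, of i \<Omega>]
    by (simp add: ext_char_fun_eq defect_vec_in_defect_space prod_eq_iff)
qed

text \<open>For \<open>h\<close> in \<open>H0\<close> both \<open>cinner \<Omega> h\<close> and
  \<open>cinner \<Omega> (A i h)\<close> vanish, so the vacuum coordinate collapses to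
  \<open>- dl (A i h)\<close>; the rest is \<open>creation_dl_words_has_sum\<close>.\<close>

lemma ext_char_fun_H0:
  assumes "h \<in> H0"
  shows "ext_char_fun A \<Omega> \<omega> (defect_vec A i h) =
    (0, - (vacuum \<otimes> dl (A i h)) + (\<Sum>\<^sub>\<infinity>j. creation j (dl_words (coord (defect_vec A i h) j))))"
proof -
  let ?x = "defect_vec A i h"
  have "coord (snd (\<Phi> ?x)) [] = - dl (A i h)"
  proof (rule ell2_eqI)
    fix j
    show "coord (coord (snd (\<Phi> ?x)) []) j = coord (- dl (A i h)) j"
      using assms
      by (simp add: coord_\<Phi>_Nil row_defect_vec coord_defect_vec cinner_diff_right coord_dl
          cinner_ell cinner_A_\<Omega> H0_iff)
  qed
  hence vac: "- (vacuum \<otimes> dl (A i h)) = vacuum \<otimes> coord (snd (\<Phi> ?x)) []"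
    by (intro ell2_eqI) (simp add: scaleC_minus_right)
  show ?thesis
    using fst_\<Phi>[OF row_defect_vec, of i h]
    unfolding vac infsumI[OF creation_dl_words_has_sum[of ?x]]
    by (simp add: ext_char_fun_eq defect_vec_in_defect_space prod_eq_iff)
qed

end

text \<open>The series come with summability clauses because \<open>infsum\<close> defaults to 0
  without convergence. The leading 0 of the values is the scalar component of the dilation space,
  and \<open>if j = i\<close> encodes the Kronecker delta.\<close>

theorem mainTheorem4:
  fixes A :: "'d :: countable \<Rightarrow> 'h :: chilbert_space \<Rightarrow> 'h"
    and \<Omega> :: 'h
    and \<omega> :: "('d, complex) ell2"
  assumes "infinite (UNIV :: 'd set) \<or> CARD('d) \<ge> 2"
    and "separable_space (euclidean :: 'h topology)"
    and "row_contraction A" and "coisometric A" and "ergodic A"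
    and "norm \<Omega> = 1"
    and "((\<lambda>i. (cmod (coord \<omega> i))\<^sup>2) has_sum 1) UNIV"
    and "\<forall>i. adj (A i) \<Omega> = cnj (coord \<omega> i) *\<^sub>C \<Omega>"
  defines "\<theta> \<equiv> ext_char_fun A \<Omega> \<omega>"
    and "d \<equiv> defect_vec A"
    and "l \<equiv> ell A \<Omega> \<omega>"
    and "H0 \<equiv> corth_compl {\<Omega>}"
    and "A0 \<equiv> ring_op A \<Omega>"
    and "D \<equiv> hat_D A \<Omega> \<omega>"
  shows
    "(\<forall>x\<in>defect_space A. \<theta> x \<in> {0} \<times> fock_tensor (scalar_defect_space \<omega>)) \<and>

     (\<forall>i.
       (\<lambda>j. cinner (A j \<Omega>) (A i \<Omega>) *\<^sub>C basis j) summable_on UNIV \<and>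
       (\<forall>\<alpha>. (\<lambda>j. cinner (word_op A0 \<alpha> (l j)) (l i) *\<^sub>C basis j) summable_on UNIV) \<and>
       (\<lambda>\<alpha>. basis \<alpha> \<otimes> (\<Sum>\<^sub>\<infinity>j. cinner (word_op A0 \<alpha> (l j)) (l i) *\<^sub>C basis j))
          summable_on {\<alpha>. length \<alpha> \<ge> 1} \<and>
       \<theta> (d i \<Omega>) =
         (0, vacuum \<otimes> (basis i - (\<Sum>\<^sub>\<infinity>j. cinner (A j \<Omega>) (A i \<Omega>) *\<^sub>C basis j))
             - (\<Sum>\<^sub>\<infinity>\<alpha>\<in>{\<alpha>. length \<alpha> \<ge> 1}.
                  basis \<alpha> \<otimes> (\<Sum>\<^sub>\<infinity>j. cinner (word_op A0 \<alpha> (l j)) (l i) *\<^sub>C basis j)))) \<and>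

     (\<forall>h\<in>H0. (\<lambda>j. cinner (l j) h *\<^sub>C basis j) summable_on UNIV) \<and>

     (\<forall>i. \<forall>h\<in>H0.
       (\<forall>j. (\<lambda>\<alpha>. basis \<alpha> \<otimes>
          D (adj_on H0 (word_op A0 \<alpha>) ((if j = i then h else 0) - adj_on H0 (A0 j) (A0 i h))))
          summable_on UNIV) \<and>
       (\<lambda>j. creation j (\<Sum>\<^sub>\<infinity>\<alpha>. basis \<alpha> \<otimes>
          D (adj_on H0 (word_op A0 \<alpha>) ((if j = i then h else 0) - adj_on H0 (A0 j) (A0 i h)))))
          summable_on UNIV \<and>
       \<theta> (d i h) =
         (0, - (vacuum \<otimes> D (A0 i h)) +
             (\<Sum>\<^sub>\<infinity>j. creation j (\<Sum>\<^sub>\<infinity>\<alpha>. basis \<alpha> \<otimes>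
                D (adj_on H0 (word_op A0 \<alpha>) ((if j = i then h else 0) - adj_on H0 (A0 j) (A0 i h)))))))"
proof -
  interpret ergodic_row A \<Omega> \<omega>
    using assms by unfold_locales auto
  have part\<Omega>: "(\<lambda>j. cinner (A j \<Omega>) (A i \<Omega>) *\<^sub>C basis j) summable_on UNIV \<and>
       (\<forall>\<alpha>. (\<lambda>j. cinner (word_op A0 \<alpha> (l j)) (l i) *\<^sub>C basis j) summable_on UNIV) \<and>
       (\<lambda>\<alpha>. basis \<alpha> \<otimes> (\<Sum>\<^sub>\<infinity>j. cinner (word_op A0 \<alpha> (l j)) (l i) *\<^sub>C basis j))
          summable_on {\<alpha>. length \<alpha> \<ge> 1} \<and>
       \<theta> (d i \<Omega>) =
         (0, vacuum \<otimes> (basis i - (\<Sum>\<^sub>\<infinity>j. cinner (A j \<Omega>) (A i \<Omega>) *\<^sub>C basis j))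
             - (\<Sum>\<^sub>\<infinity>\<alpha>\<in>{\<alpha>. length \<alpha> \<ge> 1}.
                  basis \<alpha> \<otimes> (\<Sum>\<^sub>\<infinity>j. cinner (word_op A0 \<alpha> (l j)) (l i) *\<^sub>C basis j)))" for i
    \<comment> \<open>The infinite sums are replaced by their closed values; evaluating the inner
      ones brings the outer one into the form of \<open>dl_words_nonempty_has_sum\<close>.\<close>
    unfolding \<theta>_def d_def l_def A0_def infsumI[OF cinner_ring_word_has_sum]
      infsumI[OF cinner_A_\<Omega>_has_sum] infsumI[OF dl_words_nonempty_has_sum]
    using ext_char_fun_\<Omega> has_sum_imp_summable[OF cinner_A_\<Omega>_has_sum]
      has_sum_imp_summable[OF cinner_ring_word_has_sum]
      has_sum_imp_summable[OF dl_words_nonempty_has_sum]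
    by blast
  have partH0: "(\<forall>j. (\<lambda>\<alpha>. basis \<alpha> \<otimes>
          D (adj_on H0 (word_op A0 \<alpha>) ((if j = i then h else 0) - adj_on H0 (A0 j) (A0 i h))))
          summable_on UNIV) \<and>
       (\<lambda>j. creation j (\<Sum>\<^sub>\<infinity>\<alpha>. basis \<alpha> \<otimes>
          D (adj_on H0 (word_op A0 \<alpha>) ((if j = i then h else 0) - adj_on H0 (A0 j) (A0 i h)))))
          summable_on UNIV \<and>
       \<theta> (d i h) =
         (0, - (vacuum \<otimes> D (A0 i h)) +
             (\<Sum>\<^sub>\<infinity>j. creation j (\<Sum>\<^sub>\<infinity>\<alpha>. basis \<alpha> \<otimes>
                D (adj_on H0 (word_op A0 \<alpha>) ((if j = i then h else 0) - adj_on H0 (A0 j) (A0 i h))))))"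
    if "h \<in> H0" for i h
  proof -
    have h: "h \<in> corth_compl {\<Omega>}" using that by (simp add: H0_def)
    hence A0: "ring_op A \<Omega> i h = A i h" by (simp add: ring_op_def)
    show ?thesis
      unfolding \<theta>_def d_def A0_def D_def H0_def hat_D_adj_on[OF h] infsumI[OF dl_words_has_sum]
      unfolding A0 hat_D_eq
      using ext_char_fun_H0[OF h] has_sum_imp_summable[OF dl_words_has_sum]
        has_sum_imp_summable[OF creation_dl_words_has_sum]
      by blast
  qed
  have "(\<lambda>j. cinner (l j) h *\<^sub>C basis j) summable_on UNIV" for h
    unfolding l_def by (rule has_sum_imp_summable[OF cinner_ell_has_sum])
  with part\<Omega> partH0 show ?thesis
    using ext_char_fun_in_fock_tensor unfolding \<theta>_def by blast
qed

end
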